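(* Under the general assumptions, let $\lambda\neq0$ be a simple eigenvalue of $T$ with eigenfunction $u$, $(\lambda_n)_n$ a sequence of eigenvalues of $\widehat{T_n}$ such that $\lambda_n\to\lambda$, and $(u_n)_n$ a corresponding sequence of eigenfunctions. Define $\mathcal{F}=\mathcal{K}\cup(u\cdot\mathcal{H})\cup(\mathcal{H}\cdot\mathcal{H})$. Then there exists a constant $C'>0$ (which only depends on the similarity function $k$, on $\sigma(T)$ and on $\lambda$) and a sequence $(a_n)_n$ of signs $a_n\in\{+1,-1\}$ such that $$\|a_nu_n-u\|_\infty\le C'\sup_{f\in\mathcal{F}}|P_nf-Pf|.$$
   Context: General assumptions: $\mathcal{X}$ is a compact metric space with Borel $\sigma$-algebra, $P$ a probability measure on $\mathcal{X}$ whose support is $\mathcal{X}$; the sample points $X_1,X_2,\dots$ are drawn independently according to $P$, and $P_n=\frac1n\sum_{i=1}^n\delta_{X_i}$; the similarity function $k:\mathcal{X}\times\mathcal{X}\to\mathbb{R}$ is symmetric and continuous, and there is a constant $l>0$ with $k(x,y)>l$ for all $x,y\in\mathcal{X}$. For a probability measure $Q$ write $Qf=\int f\,dQ$. Let $d_n(x)=\int k(x,y)\,dP_n(y)$, $d(x)=\int k(x,y)\,dP(y)$, $h_n(x,y)=k(x,y)/\sqrt{d_n(x)d_n(y)}$, $h(x,y)=k(x,y)/\sqrt{d(x)d(y)}$. Operators on the Banach space $(C(\mathcal{X}),\|\cdot\|_\infty)$ of continuous functions: $\widehat{T_n}f(x)=\int h_n(x,y)f(y)\,dP_n(y)$ and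 $Tf(x)=\int h(x,y)f(y)\,dP(y)$. $\sigma(T)$ is the spectrum of $T$; an eigenvalue is simple if it has algebraic multiplicity 1. Function classes: $\mathcal{K}=\{k(x,\cdot):x\in\mathcal{X}\}$, $\mathcal{H}=\{h(x,\cdot):x\in\mathcal{X}\}$, $u\cdot\mathcal{H}=\{u(\cdot)h(x,\cdot):x\in\mathcal{X}\}$, $\mathcal{H}\cdot\mathcal{H}=\{h(x,\cdot)h(y,\cdot):x,y\in\mathcal{X}\}$.
   Formalization: The inequality is proved for all sufficiently large n (threshold may depend on the outcome and the sequences) rather than every n, and u and u_n are normalised to sup norm 1; without either change the claim fails, e.g. on a two-point space when P_2 = P. *)

theory Defs
  imports "HOL-Probability.Probability"
begin

definition spectrum :: "('b::real_normed_vector \<Rightarrow> 'b) \<Rightarrow> real set" where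
  "spectrum T = {t. \<not> (\<exists>R. bounded_linear R \<and>
     (\<forall>f. R (T f - t *\<^sub>R f) = f) \<and> (\<forall>f. T (R f) - t *\<^sub>R R f = f))}"

definition eigenpair :: "('b::real_vector \<Rightarrow> 'b) \<Rightarrow> real \<Rightarrow> 'b \<Rightarrow> bool" where
  "eigenpair T t f \<longleftrightarrow> f \<noteq> 0 \<and> T f = t *\<^sub>R f"

definition generalized_eigenspace :: "('b::real_vector \<Rightarrow> 'b) \<Rightarrow> real \<Rightarrow> 'b set" where
  "generalized_eigenspace T t = {f. \<exists>j. ((\<lambda>g. T g - t *\<^sub>R g) ^^ j) f = 0}"

text \<open>Since \<^const>\<open>dim\<close> is 0 on infinite-dimensional spaces, the value 1 really means
  that the generalized eigenspace is a line.\<close>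

definition algebraic_multiplicity :: "('b::real_vector \<Rightarrow> 'b) \<Rightarrow> real \<Rightarrow> nat" where
  "algebraic_multiplicity T t = dim (generalized_eigenspace T t)"

definition simple_eigenvalue :: "('b::real_vector \<Rightarrow> 'b) \<Rightarrow> real \<Rightarrow> bool" where
  "simple_eigenvalue T t \<longleftrightarrow> (\<exists>f. eigenpair T t f) \<and> algebraic_multiplicity T t = 1"

definition similarity_function :: "('a::metric_space \<Rightarrow> 'a \<Rightarrow> real) \<Rightarrow> bool" where
  "similarity_function k \<longleftrightarrow>
     (\<forall>x y. k x y = k y x) \<and>
     continuous_on UNIV (\<lambda>(x, y). k x y) \<and>
     (\<exists>l>0. \<forall>x y. k x y > l)"

text \<open>The measure is a parameter: the population measure \<open>P\<close> gives \<open>d\<close>, \<open>h\<close>, \<open>T\<close>, and the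
  empirical measure \<open>P\<^sub>n\<close> gives \<open>d\<^sub>n\<close>, \<open>h\<^sub>n\<close> and the empirical operator.\<close>

definition degree_fun :: "('a \<Rightarrow> 'a \<Rightarrow> real) \<Rightarrow> 'a measure \<Rightarrow> 'a \<Rightarrow> real" where
  "degree_fun k Q x = (\<integral>y. k x y \<partial>Q)"

definition normalized_kernel :: "('a \<Rightarrow> 'a \<Rightarrow> real) \<Rightarrow> 'a measure \<Rightarrow> 'a \<Rightarrow> 'a \<Rightarrow> real" where
  "normalized_kernel k Q x y = k x y / sqrt (degree_fun k Q x * degree_fun k Q y)"

text \<open>On a compact space, \<^typ>\<open>'a \<Rightarrow>\<^sub>C real\<close> is the Banach space of all continuous
  functions with the supremum norm. The lemma \<open>apply_normalized_op\<close> below shows that the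
  abstraction \<^const>\<open>Bcontfun\<close> is applied to a continuous function.\<close>

definition normalized_op ::
    "('a::metric_space \<Rightarrow> 'a \<Rightarrow> real) \<Rightarrow> 'a measure \<Rightarrow> ('a \<Rightarrow>\<^sub>C real) \<Rightarrow> ('a \<Rightarrow>\<^sub>C real)" where
  "normalized_op k Q f = Bcontfun (\<lambda>x. \<integral>y. normalized_kernel k Q x y * f y \<partial>Q)"

text \<open>\<open>x 0, \<dots>, x (n - 1)\<close> are the first \<open>n\<close> sample points, possibly with repetitions.\<close>

definition empirical_measure :: "(nat \<Rightarrow> 'a::topological_space) \<Rightarrow> nat \<Rightarrow> 'a measure" where
  "empirical_measure x n = distr (uniform_count_measure {..<n}) borel x"

definition iid_sample ::
    "'a::metric_space measure \<Rightarrow> 'w measure \<Rightarrow> (nat \<Rightarrow> 'w \<Rightarrow> 'a) \<Rightarrow> bool" where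
  "iid_sample P M X \<longleftrightarrow>
     prob_space M \<and> prob_space.indep_vars M (\<lambda>_. borel) X UNIV \<and>
     (\<forall>i. distr M borel (X i) = P)"

definition full_support_prob :: "'a::metric_space measure \<Rightarrow> bool" where
  "full_support_prob P \<longleftrightarrow>
     prob_space P \<and> sets P = sets borel \<and>
     (\<forall>U. open U \<and> U \<noteq> {} \<longrightarrow> emeasure P U > 0)"

definition error_class ::
    "('a::metric_space \<Rightarrow> 'a \<Rightarrow> real) \<Rightarrow> 'a measure \<Rightarrow> ('a \<Rightarrow>\<^sub>C real) \<Rightarrow> ('a \<Rightarrow> real) set" where
  "error_class k P u =
     {k x | x. True} \<union>
     {\<lambda>y. u y * normalized_kernel k P x y | x. True} \<union>
     {\<lambda>z. normalized_kernel k P x z * normalized_kernel k P y z | x y. True}"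

lemma integral_empirical_measure:
  fixes f :: "'a::topological_space \<Rightarrow> real"
  assumes "f \<in> borel_measurable borel"
  shows "(\<integral>y. f y \<partial>empirical_measure x n) = (\<Sum>i<n. f (x i)) / n"
proof -
  have "x \<in> measurable (uniform_count_measure {..<n}) borel"
    by (auto simp: measurable_def space_uniform_count_measure sets_uniform_count_measure)
  then show ?thesis
    using assms by (simp add: empirical_measure_def integral_distr integral_uniform_count_measure)
qed

lemma prob_space_empirical_measure:
  assumes "n > 0"
  shows "prob_space (empirical_measure x n)" "sets (empirical_measure x n) = sets borel"
proof -
  have m: "x \<in> measurable (uniform_count_measure {..<n}) borel"
    by (auto simp: measurable_def space_uniform_count_measure sets_uniform_count_measure)
  have "prob_space (uniform_count_measure {..<n})"
    using assms by (intro prob_space_uniform_count_measure) auto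
  then show "prob_space (empirical_measure x n)"
    unfolding empirical_measure_def by (rule prob_space.prob_space_distr[OF _ m])
qed (simp add: empirical_measure_def)

lemma continuous_kernel_integral:
  fixes g :: "'a::metric_space \<Rightarrow> 'a \<Rightarrow> real"
  assumes "compact (UNIV :: 'a set)" "prob_space Q" "sets Q = sets borel"
    and g: "continuous_on UNIV (\<lambda>(x, y). g x y)"
  shows "continuous_on UNIV (\<lambda>x. \<integral>y. g x y \<partial>Q)"
proof -
  interpret prob_space Q by fact
  have "compact ((\<lambda>(x, y). g x y) ` (UNIV \<times> UNIV))"
    using assms(1) g by (intro compact_continuous_image compact_Times) auto
  then obtain B where B: "\<And>x y. norm (g x y) \<le> B"
    by (force dest!: compact_imp_bounded simp: bounded_iff)
  have c1: "continuous_on UNIV (\<lambda>y. g x y)" for x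
    using continuous_on_compose2[OF g continuous_on_Pair[OF continuous_on_const continuous_on_id]] by simp
  have c2: "continuous_on UNIV (\<lambda>x. g x y)" for y
    using continuous_on_compose2[OF g continuous_on_Pair[OF continuous_on_id continuous_on_const]] by simp
  have meas: "g x \<in> borel_measurable Q" for x
    using borel_measurable_continuous_onI[OF c1[of x]] assms(3)
    by (simp cong: measurable_cong_sets)
  have "(\<lambda>n. \<integral>y. g (s n) y \<partial>Q) \<longlonglongrightarrow> (\<integral>y. g x y \<partial>Q)" if "s \<longlonglongrightarrow> x" for s x
  proof (rule integral_dominated_convergence[where w = "\<lambda>_. B"])
    show "AE y in Q. (\<lambda>n. g (s n) y) \<longlonglongrightarrow> g x y"
      using c2 that by (auto intro!: AE_I2 simp: continuous_on_sequentially o_def)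
  qed (use meas B in auto)
  then show ?thesis
    by (auto simp: continuous_on_sequentially o_def)
qed

lemma apply_normalized_op:
  fixes k :: "'a::metric_space \<Rightarrow> 'a \<Rightarrow> real"
  assumes c: "compact (UNIV :: 'a set)" and Q: "prob_space Q" "sets Q = sets borel"
    and k: "similarity_function k"
  shows "apply_bcontfun (normalized_op k Q f) x = (\<integral>y. normalized_kernel k Q x y * f y \<partial>Q)"
proof -
  interpret prob_space Q by fact
  have kc: "continuous_on UNIV (\<lambda>(x, y). k x y)"
    using k by (simp add: similarity_function_def)
  obtain l where l: "l > 0" "\<And>x y. k x y > l"
    using k by (auto simp: similarity_function_def)
  have "compact ((\<lambda>(x, y). k x y) ` (UNIV \<times> UNIV))"
    using c kc by (intro compact_continuous_image compact_Times) auto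
  then obtain B where B: "\<And>x y. norm (k x y) \<le> B"
    by (force dest!: compact_imp_bounded simp: bounded_iff)
  have dc: "continuous_on UNIV (degree_fun k Q)"
    unfolding degree_fun_def by (rule continuous_kernel_integral[OF c Q kc])
  have dpos: "degree_fun k Q x > 0" for x
  proof -
    have "continuous_on UNIV (k x)"
      using continuous_on_compose2[OF kc continuous_on_Pair[OF continuous_on_const continuous_on_id]] by simp
    then have "k x \<in> borel_measurable Q"
      using borel_measurable_continuous_onI[of "k x"] Q by (simp cong: measurable_cong_sets)
    then have "integrable Q (k x)"
      using B by (intro integrable_const_bound[where B = B]) auto
    then have "(\<integral>y. l \<partial>Q) \<le> degree_fun k Q x"
      unfolding degree_fun_def using l by (intro integral_mono) (auto intro: less_imp_le)
    then show ?thesis using l by (simp add: prob_space)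
  qed
  have d1: "continuous_on UNIV (\<lambda>p. degree_fun k Q (fst p :: 'a))"
    and d2: "continuous_on UNIV (\<lambda>p. degree_fun k Q (snd p :: 'a))"
    and d3: "continuous_on UNIV (\<lambda>p. apply_bcontfun f (snd p))"
    by (rule continuous_on_compose2[OF dc] continuous_on_compose2[OF continuous_on_apply_bcontfun];
        auto intro: continuous_intros)+
  have "continuous_on UNIV (\<lambda>p. normalized_kernel k Q (fst p) (snd p) * f (snd p))"
    unfolding normalized_kernel_def
    using kc dpos by (intro continuous_intros d1 d2 d3)
      (auto simp: case_prod_unfold less_imp_neq[symmetric] less_imp_neq[THEN not_sym])
  then have "continuous_on UNIV (\<lambda>(x, y). normalized_kernel k Q x y * f y)"
    by (simp add: case_prod_unfold)
  then have *: "continuous_on UNIV (\<lambda>x. \<integral>y. normalized_kernel k Q x y * f y \<partial>Q)"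
    by (rule continuous_kernel_integral[OF c Q])
  then have "(\<lambda>x. \<integral>y. normalized_kernel k Q x y * f y \<partial>Q) \<in> bcontfun"
    using c compact_continuous_image[OF * c] by (auto simp: bcontfun_def compact_imp_bounded)
  then show ?thesis
    by (simp add: normalized_op_def Bcontfun_inverse)
qed

end

theory Submission
  imports Defs "HOL-Complex_Analysis.Great_Picard"
begin

text \<open>Decompose an eigenfunction of the empirical operator as \<open>v = c u + w\<close> with \<open>w\<close> orthogonal to \<open>u\<close>
  in \<open>L\<^sup>2(P)\<close>. As \<open>T\<close> is symmetric there, \<open>(T - \<mu>) w\<close> is the component of \<open>r = (T - T\<^sub>n) v\<close> orthogonal
  to \<open>u\<close>, so the gap of \<open>T - \<lambda>\<close> on the complement of \<open>u\<close> bounds the \<open>L\<^sup>2\<close> norm of \<open>w\<close> by that of \<open>r\<close>,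
  and \<open>\<mu> w = T w - r\<^sup>\<bottom>\<close> turns this into a bound on the supremum norm, because \<open>T\<close> maps \<open>L\<^sup>2(P)\<close>
  boundedly into the continuous functions. Replacing \<open>v\<close> in \<open>r\<close> by \<open>T\<^sub>n v / \<mu>\<close> bounds \<open>r\<close> by the
  errors on products of two kernels and on the degree functions. The gap is controlled by the
  spectrum: by compactness it is attained at an eigenvalue.\<close>

section \<open>Smoothing operators that are symmetric for a weaker inner product\<close>

text \<open>\<open>C'\<close> is chosen before the measure, so a constant may depend on
  \<open>P\<close> only through the spectrum. Everything explicit is a function of \<open>l\<close>,
  \<open>B\<close> and \<open>lam\<close>; only the gap is delicate. It takes two converse facts:
  the best gap, if it lies below \<open>|lam|\<close>, is the distance from \<open>lam\<close> to
  another point of the spectrum, and any gap keeps the other nonzero points of the spectrum at least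
  that far from \<open>lam\<close>. The second fact requires inverting \<open>T - t\<close> on the
  continuous functions, while the estimates live in L2(P), for whose seminorm this space need not be
  complete. The operator is therefore axiomatized by what links the two norms:
  \<open>norm (T f)\<close> is at most \<open>H * q f\<close>, and \<open>T\<close> is compact from
  \<open>q\<close> to \<open>norm\<close>. The two operators are symmetric for different inner
  products, so all spectral theory is done for \<open>T\<close> alone; the empirical operator enters
  only through the residual \<open>T v - \<mu> v\<close> of one of its eigenvectors.\<close>

locale semi_inner =
  fixes ip :: "'b::{real_normed_vector, complete_space} \<Rightarrow> 'b \<Rightarrow> real"
  assumes ip_add: "ip (f + g) h = ip f h + ip g h"
    and ip_scale: "ip (c *\<^sub>R f) g = c * ip f g"
    and ip_sym: "ip f g = ip g f"
    and ip_nonneg: "0 \<le> ip f f"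
    and ip_le: "ip f f \<le> (norm f)\<^sup>2"
begin

section \<open>The seminorm of a semi-inner product and the Cauchy-Schwarz inequality\<close>

lemma ip_add_right: "ip h (f + g) = ip h f + ip h g"
  by (metis ip_add ip_sym)

lemma ip_scale_right: "ip g (c *\<^sub>R f) = c * ip g f"
  by (metis ip_scale ip_sym)

lemma ip_diff: "ip (f - g) h = ip f h - ip g h"
  using ip_add[of "f - g" g h] by simp

lemma ip_diff_right: "ip h (f - g) = ip h f - ip h g"
  by (metis ip_diff ip_sym)

lemmas ip_simps = ip_add ip_scale ip_add_right ip_scale_right ip_diff ip_diff_right

definition q :: "'b \<Rightarrow> real" where
  "q f = sqrt (ip f f)"

lemma q_nonneg [simp]: "0 \<le> q f"
  by (simp add: q_def ip_nonneg)

lemma q_square: "(q f)\<^sup>2 = ip f f"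
  by (simp add: q_def ip_nonneg)

lemma q_le_norm: "q f \<le> norm f"
  unfolding q_def by (rule real_le_lsqrt) (auto simp: ip_le)

lemma q_scale: "q (c *\<^sub>R f) = \<bar>c\<bar> * q f"
  by (simp add: q_def ip_simps real_sqrt_mult flip: mult.assoc)

lemma Cauchy_Schwarz: "\<bar>ip f g\<bar> \<le> q f * q g"
proof -
  have nn: "0 \<le> ip f f + 2 * s * ip f g + s\<^sup>2 * ip g g" for s
    using ip_nonneg[of "f + s *\<^sub>R g"]
    by (simp add: ip_simps ip_sym[of g f] algebra_simps power2_eq_square)
  have "(ip f g)\<^sup>2 \<le> ip f f * ip g g"
  proof (cases "ip g g = 0")
    case True
    \<comment> \<open>The form need not be definite. If \<open>ip g g\<close> vanishes, the
      quadratic in \<open>s\<close> is affine and nonnegative everywhere, so its slope is 0; the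
      \<open>s\<close> used below would give it the value -1.\<close>
    have "ip f g = 0"
    proof (rule ccontr)
      assume "ip f g \<noteq> 0"
      then have "ip f f + 2 * (- (ip f f + 1) / (2 * ip f g)) * ip f g = - 1"
        by (simp add: field_simps)
      then show False
        using nn[of "- (ip f f + 1) / (2 * ip f g)"] True by simp
    qed
    then show ?thesis using True by simp
  next
    case False
    then have pos: "ip g g > 0" using ip_nonneg[of g] by simp
    have "0 \<le> ip f f - (ip f g)\<^sup>2 / ip g g"
      using nn[of "- ip f g / ip g g"] pos
      by (simp add: field_simps power2_eq_square)
    then show ?thesis using pos by (simp add: field_simps)
  qed
  also have "\<dots> = (q f * q g)\<^sup>2"
    by (simp add: power_mult_distrib q_square)
  finally show ?thesis
    by (metis abs_le_square_iff abs_of_nonneg mult_nonneg_nonneg q_nonneg)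
qed

lemma q_triangle: "q (f + g) \<le> q f + q g"
proof -
  have "(q (f + g))\<^sup>2 = (q f)\<^sup>2 + 2 * ip f g + (q g)\<^sup>2"
    by (simp add: q_square ip_simps ip_sym[of g f])
  also have "\<dots> \<le> (q f + q g)\<^sup>2"
    using Cauchy_Schwarz[of f g] by (simp add: power2_sum)
  finally show ?thesis
    by (rule power2_le_imp_le) simp
qed

lemma q_minus: "q (- f) = q f"
  using q_scale[of "-1" f] by simp

lemma q_diff_commute: "q (f - g) = q (g - f)"
  using q_minus[of "f - g"] by simp

lemma q_triangle_diff: "q (f - g) \<le> q f + q g"
  using q_triangle[of f "- g"] by (simp add: q_minus)

lemma q_abs_diff: "\<bar>q f - q g\<bar> \<le> q (f - g)"
  using q_triangle[of "f - g" g] q_triangle[of "g - f" f] q_diff_commute[of f g] by simp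

end

text \<open>Abstracts an integral operator with continuous symmetric kernel: \<open>T_bound\<close>
  is Cauchy-Schwarz in the second kernel argument, \<open>T_compact\<close> is Arzela-Ascoli for the
  image of the \<open>q\<close>-unit ball.\<close>

locale smoothing_operator = semi_inner ip
  for ip :: "'b::{real_normed_vector, complete_space} \<Rightarrow> 'b \<Rightarrow> real" +
  fixes T :: "'b \<Rightarrow> 'b" and H :: real
  assumes T_linear: "linear T"
    and T_sym: "ip (T f) g = ip f (T g)"
    and T_bound: "norm (T f) \<le> H * q f"
    and H_pos: "0 < H"
    and T_compact: "(\<And>n. q (F n) \<le> 1) \<Longrightarrow> \<exists>r. strict_mono (r :: nat \<Rightarrow> nat) \<and> convergent (\<lambda>n. T (F (r n)))"
begin

section \<open>Passing between the seminorm and the norm\<close>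

lemma T_simps: "T (f + g) = T f + T g" "T (f - g) = T f - T g" "T (c *\<^sub>R f) = c *\<^sub>R T f" "T 0 = 0"
  using T_linear by (simp_all add: linear_add linear_diff linear_scale linear_0)

lemma T_q_bound: "q (T f) \<le> H * q f"
  using q_le_norm T_bound order_trans by blast

text \<open>This replaces completeness for \<open>q\<close>: limits are taken after one application
  of \<open>T\<close>, where they exist in norm.\<close>

lemma T_tendsto_q:
  assumes "(\<lambda>n. q (F n - f)) \<longlonglongrightarrow> 0"
  shows "(\<lambda>n. T (F n)) \<longlonglongrightarrow> T f"
proof (rule LIM_zero_cancel, rule Lim_null_comparison)
  show "\<forall>\<^sub>F n in sequentially. norm (T (F n) - T f) \<le> H * q (F n - f)"
    using T_bound by (simp flip: T_simps)
  show "(\<lambda>n. H * q (F n - f)) \<longlonglongrightarrow> 0"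
    using tendsto_mult_right_zero[OF assms] by simp
qed

lemma tendsto_norm_imp_q:
  assumes "F \<longlonglongrightarrow> f"
  shows "(\<lambda>n. q (F n - f)) \<longlonglongrightarrow> 0"
proof (rule Lim_null_comparison)
  show "\<forall>\<^sub>F n in sequentially. norm (q (F n - f)) \<le> norm (F n - f)"
    using q_le_norm by simp
  show "(\<lambda>n. norm (F n - f)) \<longlonglongrightarrow> 0"
    using assms by (simp add: LIM_zero tendsto_norm_zero)
qed

lemma T_continuous: "F \<longlonglongrightarrow> f \<Longrightarrow> (\<lambda>n. T (F n)) \<longlonglongrightarrow> T f"
  using T_tendsto_q tendsto_norm_imp_q by blast

text \<open>An eigenvector for \<open>t \<noteq> 0\<close> is \<open>T f / t\<close>, so its norm is
  controlled by \<open>q\<close>. Hence it cannot have seminorm 0, and projections onto it make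
  sense.\<close>

lemma q_eigenvector_pos:
  assumes "T f = t *\<^sub>R f" "t \<noteq> 0" "f \<noteq> 0"
  shows "\<bar>t\<bar> * norm f \<le> H * q f" "0 < q f"
proof -
  show *: "\<bar>t\<bar> * norm f \<le> H * q f"
    using T_bound[of f] assms by simp
  have "0 < \<bar>t\<bar> * norm f" using assms by simp
  with * have "0 < H * q f" by linarith
  then show "0 < q f" using H_pos zero_less_mult_pos by blast
qed

lemma eigenvalue_in_spectrum:
  assumes "T f = t *\<^sub>R f" "f \<noteq> 0"
  shows "t \<in> spectrum T"
proof -
  have "\<not> (bounded_linear R \<and> (\<forall>g. R (T g - t *\<^sub>R g) = g))" for R
    using assms by (metis cancel_comm_monoid_add_class.diff_cancel linear_simps(3))
  then show ?thesis unfolding spectrum_def by blast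
qed

section \<open>Attainment of the spectral gap\<close>

text \<open>A minimizing sequence for the quadratic form of \<open>(T - \<lambda>)\<^sup>2\<close> consists of approximate
  eigenvectors; since \<open>\<lambda>\<^sup>2 - (T - \<lambda>)\<^sup>2\<close> is compact, the infimum is attained if it is below \<open>\<lambda>\<^sup>2\<close>.\<close>

lemma infimum_attained:
  fixes lam gam :: real
  assumes u: "T u = lam *\<^sub>R u"
    and gam: "0 \<le> gam" "gam < \<bar>lam\<bar>"
    and lower: "\<And>w. ip w u = 0 \<Longrightarrow> gam * q w \<le> q (T w - lam *\<^sub>R w)"
    and w: "\<And>n::nat. ip (w n) u = 0" "\<And>n. q (w n) = 1"
    and lim: "(\<lambda>n. q (T (w n) - lam *\<^sub>R w n)) \<longlonglongrightarrow> gam"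
  shows "\<exists>g. g \<noteq> 0 \<and> ip g u = 0 \<and> (T g = (lam + gam) *\<^sub>R g \<or> T g = (lam - gam) *\<^sub>R g)"
proof -
  define A where "A f = T f - lam *\<^sub>R f" for f
  \<comment> \<open>\<open>A\<close> squared is \<open>lam\<^sup>2 - K\<close> with \<open>K\<close>
    compact. So \<open>e\<close>, which is \<open>A\<close> squared minus
    \<open>gam\<^sup>2\<close>, equals \<open>\<kappa> - K\<close>, with \<open>\<kappa> > 0\<close>
    because \<open>gam < |lam|\<close>.\<close>
  define \<kappa> where "\<kappa> = lam\<^sup>2 - gam\<^sup>2"
  define K where "K f = (2 * lam) *\<^sub>R T f - T (T f)" for f
  define e where "e f = \<kappa> *\<^sub>R f - K f" for f
  define C where "C = (H + \<bar>lam\<bar>)\<^sup>2"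
  have \<kappa>: "\<kappa> > 0"
    using gam by (simp add: \<kappa>_def abs_square_less_1 power2_strict_mono abs_le_square_iff)
  have C: "C > 0" using H_pos by (simp add: C_def)
  have ipT: "ip (T f) u = lam * ip f u" for f
    by (simp add: T_sym u ip_simps)
  have eV: "ip f u = 0 \<Longrightarrow> ip (e f) u = 0" for f
    by (simp add: e_def K_def ip_simps ipT)
  have A_sym: "ip (A f) g = ip f (A g)" for f g
    by (simp add: A_def ip_simps T_sym)
  have AA: "A (A f) = gam\<^sup>2 *\<^sub>R f + e f" for f
    by (simp add: A_def e_def K_def \<kappa>_def T_simps algebra_simps power2_eq_square
        flip: scaleR_2)
  have A_bound: "ip (A f) (A f) \<le> C * ip f f" for f
  proof -
    have "q (A f) \<le> q (T f) + \<bar>lam\<bar> * q f"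
      unfolding A_def using q_triangle_diff[of "T f" "lam *\<^sub>R f"] by (simp add: q_scale)
    also have "\<dots> \<le> (H + \<bar>lam\<bar>) * q f"
      using T_q_bound[of f] by (simp add: algebra_simps)
    finally have "(q (A f))\<^sup>2 \<le> ((H + \<bar>lam\<bar>) * q f)\<^sup>2"
      by (rule power_mono) simp
    then show ?thesis by (simp add: C_def q_square power_mult_distrib)
  qed
  have low: "gam\<^sup>2 * ip f f \<le> ip (A f) (A f)" if "ip f u = 0" for f
    using power_mono[OF lower[OF that], of 2] gam by (simp add: power_mult_distrib q_square A_def)
  have key: "ip (e f) (e f) \<le> C * (ip (A f) (A f) - gam\<^sup>2 * ip f f)" if f: "ip f u = 0" for f
  proof -
    \<comment> \<open>The form belonging to \<open>e\<close> is nonnegative on the complement of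
      \<open>u\<close>; testing it at \<open>f - s e f\<close> bounds \<open>e f\<close> by the
      value of the form at \<open>f\<close>. The linear term is \<open>- 2 s E\<close>, the
      quadratic one at most \<open>s\<^sup>2 C E\<close>, and \<open>1 / C\<close> is the optimal
      balance.\<close>
    define s where "s = 1 / C"
    define E where "E = ip (e f) (e f)"
    have cross: "ip (A f) (A (e f)) = gam\<^sup>2 * ip f (e f) + E"
      by (simp add: A_sym[symmetric, of _ "e f"] AA ip_simps E_def)
    have "0 \<le> ip (A (f - s *\<^sub>R e f)) (A (f - s *\<^sub>R e f))
            - gam\<^sup>2 * ip (f - s *\<^sub>R e f) (f - s *\<^sub>R e f)"
      using low[of "f - s *\<^sub>R e f"] f eV[OF f] by (simp add: ip_simps)
    also have "A (f - s *\<^sub>R e f) = A f - s *\<^sub>R A (e f)"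
      by (simp add: A_def T_simps algebra_simps)
    also have "ip (A f - s *\<^sub>R A (e f)) (A f - s *\<^sub>R A (e f))
          - gam\<^sup>2 * ip (f - s *\<^sub>R e f) (f - s *\<^sub>R e f)
        = ip (A f) (A f) - gam\<^sup>2 * ip f f - 2 * s * E
          + s\<^sup>2 * (ip (A (e f)) (A (e f)) - gam\<^sup>2 * E)"
      using cross
      by (simp add: ip_simps ip_sym[of "A (e f)" "A f"] ip_sym[of "e f" f] E_def[symmetric]
          algebra_simps power2_eq_square)
    finally have 1: "2 * s * E \<le> ip (A f) (A f) - gam\<^sup>2 * ip f f
        + s\<^sup>2 * (ip (A (e f)) (A (e f)) - gam\<^sup>2 * E)" by simp
    have "0 \<le> gam\<^sup>2 * E" by (simp add: E_def ip_nonneg)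
    then have "ip (A (e f)) (A (e f)) - gam\<^sup>2 * E \<le> C * E"
      using A_bound[of "e f"] by (simp add: E_def)
    then have "s\<^sup>2 * (ip (A (e f)) (A (e f)) - gam\<^sup>2 * E) \<le> s\<^sup>2 * (C * E)"
      by (rule mult_left_mono) simp
    also have "\<dots> = s * E" using C by (simp add: s_def power2_eq_square)
    finally have "s * E \<le> ip (A f) (A f) - gam\<^sup>2 * ip f f" using 1 by simp
    then show ?thesis using C by (simp add: s_def E_def field_simps)
  qed
  have e0: "(\<lambda>n. q (e (w n))) \<longlonglongrightarrow> 0"
  proof -
    have "(\<lambda>n. C * ((q (A (w n)))\<^sup>2 - gam\<^sup>2)) \<longlonglongrightarrow> C * (gam\<^sup>2 - gam\<^sup>2)"
      using lim unfolding A_def by (intro tendsto_intros)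
    then have "(\<lambda>n. C * ((q (A (w n)))\<^sup>2 - gam\<^sup>2)) \<longlonglongrightarrow> 0" by simp
    then have "(\<lambda>n. (q (e (w n)))\<^sup>2) \<longlonglongrightarrow> 0"
    proof (rule Lim_null_comparison[rotated])
      show "\<forall>\<^sub>F n in sequentially. norm ((q (e (w n)))\<^sup>2) \<le> C * ((q (A (w n)))\<^sup>2 - gam\<^sup>2)"
        using key[OF w(1)] w(2) by (simp add: q_square[symmetric])
    qed
    then have "(\<lambda>n. sqrt ((q (e (w n)))\<^sup>2)) \<longlonglongrightarrow> sqrt 0" by (rule tendsto_real_sqrt)
    then show ?thesis by simp
  qed
  obtain r g where r: "strict_mono (r :: nat \<Rightarrow> nat)" and g: "(\<lambda>n. T (w (r n))) \<longlonglongrightarrow> g"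
    using T_compact[of w] w(2) by (auto simp: convergent_def)
  \<comment> \<open>As \<open>e (w n)\<close> tends to 0, \<open>\<kappa>\<close> times
    \<open>w (r n)\<close> has the same \<open>q\<close>-limit as \<open>K (w (r n))\<close>, and
    the latter converges in norm. This puts the limit of \<open>w (r n)\<close> inside the
    space.\<close>
  define G where "G = (1 / \<kappa>) *\<^sub>R ((2 * lam) *\<^sub>R g - T g)"
  have \<kappa>G: "\<kappa> *\<^sub>R G = (2 * lam) *\<^sub>R g - T g" using \<kappa> by (simp add: G_def)
  have "(\<lambda>n. K (w (r n))) \<longlonglongrightarrow> \<kappa> *\<^sub>R G"
    unfolding K_def \<kappa>G by (intro tendsto_intros g T_continuous)
  then have K0: "(\<lambda>n. q (K (w (r n)) - \<kappa> *\<^sub>R G)) \<longlonglongrightarrow> 0" by (rule tendsto_norm_imp_q)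
  have e0r: "(\<lambda>n. q (e (w (r n)))) \<longlonglongrightarrow> 0"
    using LIMSEQ_subseq_LIMSEQ[OF e0 r] by (simp add: o_def)
  have wG: "(\<lambda>n. q (w (r n) - G)) \<longlonglongrightarrow> 0"
  proof (rule Lim_null_comparison)
    show "\<forall>\<^sub>F n in sequentially. norm (q (w (r n) - G))
        \<le> (1 / \<kappa>) * (q (e (w (r n))) + q (K (w (r n)) - \<kappa> *\<^sub>R G))"
    proof (rule always_eventually, rule allI)
      fix n
      have "\<kappa> *\<^sub>R (w (r n) - G) = e (w (r n)) + (K (w (r n)) - \<kappa> *\<^sub>R G)"
        by (simp add: e_def algebra_simps)
      then have "\<kappa> * q (w (r n) - G) = q (e (w (r n)) + (K (w (r n)) - \<kappa> *\<^sub>R G))"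
        using q_scale[of \<kappa> "w (r n) - G"] \<kappa> by simp
      also have "\<dots> \<le> q (e (w (r n))) + q (K (w (r n)) - \<kappa> *\<^sub>R G)" by (rule q_triangle)
      finally show "norm (q (w (r n) - G)) \<le> (1 / \<kappa>) * (q (e (w (r n))) + q (K (w (r n)) - \<kappa> *\<^sub>R G))"
        using \<kappa> by (simp add: field_simps)
    qed
    show "(\<lambda>n. (1 / \<kappa>) * (q (e (w (r n))) + q (K (w (r n)) - \<kappa> *\<^sub>R G))) \<longlonglongrightarrow> 0"
      using tendsto_mult_left[OF tendsto_add[OF e0r K0], of "1 / \<kappa>"] by simp
  qed
  have gTG: "g = T G"
    using LIMSEQ_unique[OF g T_tendsto_q[OF wG]] .
  have "q G = 1"
  proof -
    have "norm (1 - q G) \<le> q (w (r n) - G)" for n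
      using q_abs_diff[of "w (r n)" G] w(2) by simp
    then have "(\<lambda>n::nat. 1 - q G) \<longlonglongrightarrow> 0"
      by (intro Lim_null_comparison[OF _ wG]) simp
    then show ?thesis by (simp add: LIMSEQ_const_iff)
  qed
  then have G0: "G \<noteq> 0" using q_scale[of 0 G] by auto
  have GV: "ip G u = 0"
  proof -
    have "norm (- ip G u) \<le> q (w (r n) - G) * q u" for n
      using Cauchy_Schwarz[of "w (r n) - G" u] w(1) by (simp add: ip_simps)
    then have "(\<lambda>n::nat. - ip G u) \<longlonglongrightarrow> 0"
      by (intro Lim_null_comparison[OF _ tendsto_mult_left_zero[OF wG, of "q u"]]) simp
    then show ?thesis by (simp add: LIMSEQ_const_iff)
  qed
  have "e G = 0" using \<kappa>G by (simp add: e_def K_def gTG)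
  then have AAG: "A (A G) = gam\<^sup>2 *\<^sub>R G" by (simp add: AA)
  show ?thesis
  \<comment> \<open>Factor \<open>A\<close> squared minus \<open>gam\<^sup>2\<close> as
    \<open>(A - gam) (A + gam)\<close>: either \<open>A + gam\<close> kills \<open>G\<close>, or it
    maps \<open>G\<close> to an eigenvector of \<open>A\<close> for \<open>gam\<close>.\<close>
  proof (cases "A G + gam *\<^sub>R G = 0")
    case True
    then have "T G = (lam - gam) *\<^sub>R G" by (simp add: A_def algebra_simps)
    then show ?thesis using G0 GV by blast
  next
    case False
    define g' where "g' = A G + gam *\<^sub>R G"
    have "A g' = A (A G) + gam *\<^sub>R A G" by (simp add: g'_def A_def T_simps algebra_simps)
    also have "\<dots> = gam *\<^sub>R g'" by (simp add: AAG g'_def algebra_simps power2_eq_square)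
    finally have "T g' = (lam + gam) *\<^sub>R g'" by (simp add: A_def algebra_simps)
    moreover have "ip g' u = 0" by (simp add: g'_def A_def ip_simps GV ipT)
    ultimately show ?thesis using False g'_def by blast
  qed
qed

text \<open>The threshold \<open>|lam|\<close> is where compactness stops helping: below it the
  infimum is attained, otherwise \<open>|lam|\<close> itself serves as gap. The final disjunction is
  what later frees the gap from its dependence on the measure.\<close>

lemma spectral_gap:
  assumes lam: "lam \<noteq> 0" and u: "T u = lam *\<^sub>R u" "u \<noteq> 0"
    and simple: "\<And>f. T f = lam *\<^sub>R f \<Longrightarrow> f \<in> span {u}"
  shows "\<exists>gam>0. (\<forall>w. ip w u = 0 \<longrightarrow> gam * q w \<le> q (T w - lam *\<^sub>R w)) \<and>
    (gam \<ge> \<bar>lam\<bar> \<or> lam + gam \<in> spectrum T \<or> lam - gam \<in> spectrum T)"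
proof (cases "\<forall>w. ip w u = 0 \<longrightarrow> \<bar>lam\<bar> * q w \<le> q (T w - lam *\<^sub>R w)")
  case True
  then show ?thesis using lam by (intro exI[of _ "\<bar>lam\<bar>"]) auto
next
  case False
  define Z where "Z = {w. ip w u = 0 \<and> q w = 1}"
  define gam where "gam = (INF w\<in>Z. q (T w - lam *\<^sub>R w))"
  have bdd: "bdd_below ((\<lambda>w. q (T w - lam *\<^sub>R w)) ` Z)"
    by (rule bdd_belowI[of _ 0]) auto
  have normalize: "(1 / q w) *\<^sub>R w \<in> Z"
    "q (T ((1 / q w) *\<^sub>R w) - lam *\<^sub>R ((1 / q w) *\<^sub>R w)) = q (T w - lam *\<^sub>R w) / q w"
    if "ip w u = 0" "q w > 0" for w
  proof -
    show "(1 / q w) *\<^sub>R w \<in> Z" using that by (simp add: Z_def ip_simps q_scale)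
    have "T ((1 / q w) *\<^sub>R w) - lam *\<^sub>R ((1 / q w) *\<^sub>R w) = (1 / q w) *\<^sub>R (T w - lam *\<^sub>R w)"
      by (simp add: T_simps algebra_simps)
    then show "q (T ((1 / q w) *\<^sub>R w) - lam *\<^sub>R ((1 / q w) *\<^sub>R w)) = q (T w - lam *\<^sub>R w) / q w"
      using that by (simp only: q_scale) simp
  qed
  obtain w0 where w0: "ip w0 u = 0" "q (T w0 - lam *\<^sub>R w0) < \<bar>lam\<bar> * q w0"
    using False by force
  have "0 < \<bar>lam\<bar> * q w0" using w0(2) q_nonneg[of "T w0 - lam *\<^sub>R w0"] by linarith
  then have qw0: "q w0 > 0" using lam by (simp add: zero_less_mult_iff)
  have Z: "Z \<noteq> {}" using normalize(1)[OF w0(1) qw0] by auto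
  have gam0: "0 \<le> gam" unfolding gam_def using Z by (intro cINF_greatest) auto
  have "gam \<le> q (T w0 - lam *\<^sub>R w0) / q w0"
    unfolding gam_def using cINF_lower[OF bdd normalize(1)[OF w0(1) qw0]] normalize(2)[OF w0(1) qw0] by simp
  also have "\<dots> < \<bar>lam\<bar>" using w0(2) qw0 by (simp add: field_simps)
  finally have gam1: "gam < \<bar>lam\<bar>" .
  have lower: "gam * q w \<le> q (T w - lam *\<^sub>R w)" if "ip w u = 0" for w
  proof (cases "q w = 0")
    case False
    then have qw: "q w > 0" using q_nonneg[of w] by linarith
    have "gam \<le> q (T w - lam *\<^sub>R w) / q w"
      unfolding gam_def using cINF_lower[OF bdd normalize(1)[OF that qw]] normalize(2)[OF that qw] by simp
    then show ?thesis using qw by (simp add: field_simps)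
  qed simp
  have "\<exists>w\<in>Z. q (T w - lam *\<^sub>R w) < gam + 1 / Suc n" for n
    using cINF_less_iff[OF Z bdd, of "gam + 1 / Suc n"] by (simp add: gam_def)
  then obtain w where w: "\<And>n. w n \<in> Z" "\<And>n. q (T (w n) - lam *\<^sub>R w n) < gam + 1 / Suc n"
    by metis
  have "(\<lambda>n. q (T (w n) - lam *\<^sub>R w n)) \<longlonglongrightarrow> gam"
  proof (rule tendsto_sandwich[of "\<lambda>_. gam" _ _ "\<lambda>n. gam + 1 / Suc n"])
    show "\<forall>\<^sub>F n in sequentially. gam \<le> q (T (w n) - lam *\<^sub>R w n)"
      unfolding gam_def using bdd w(1) by (intro always_eventually allI cINF_lower)
    show "(\<lambda>n. gam + 1 / Suc n) \<longlonglongrightarrow> gam"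
      using tendsto_add[OF tendsto_const LIMSEQ_inverse_real_of_nat, of gam] by (simp add: inverse_eq_divide)
    show "\<forall>\<^sub>F n in sequentially. q (T (w n) - lam *\<^sub>R w n) \<le> gam + 1 / Suc n"
      using w(2) by (intro always_eventually allI less_imp_le)
  qed simp
  then obtain g where g: "g \<noteq> 0" "ip g u = 0" "T g = (lam + gam) *\<^sub>R g \<or> T g = (lam - gam) *\<^sub>R g"
    using infimum_attained[OF u(1) gam0 gam1 lower] w(1) by (auto simp: Z_def)
  \<comment> \<open>Simplicity enters here: for \<open>gam = 0\<close> the minimizer would be a
    multiple of \<open>u\<close> and orthogonal to \<open>u\<close>.\<close>
  have "gam \<noteq> 0"
  proof
    assume "gam = 0"
    then have "T g = lam *\<^sub>R g" using g(3) by simp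
    then obtain c where c: "g = c *\<^sub>R u" using simple by (auto simp: span_singleton)
    have "c * (q u)\<^sup>2 = 0" using g(2) by (simp add: c ip_simps q_square)
    then show False using q_eigenvector_pos(2)[OF u(1) lam u(2)] g(1) c by auto
  qed
  then have "gam > 0" using gam0 by simp
  moreover have "lam + gam \<in> spectrum T \<or> lam - gam \<in> spectrum T"
    using g eigenvalue_in_spectrum by blast
  ultimately show ?thesis using lower by blast
qed

section \<open>Resolvents from lower bounds, and isolation of the eigenvalue\<close>

text \<open>Gradient steps \<open>w + (T - t) e / M\<^sup>2\<close> contract the residual \<open>e = f - (T - t) w\<close> geometrically. The space is
  not complete for the seminorm \<open>q\<close>, but \<open>T\<close> maps sequences that are Cauchy for \<open>q\<close> to convergent ones.\<close>

lemma not_in_spectrum: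
  assumes t: "t \<noteq> 0" and gam: "gam > 0" and lower: "\<And>f. gam * q f \<le> q (T f - t *\<^sub>R f)"
  shows "t \<notin> spectrum T"
proof -
  define A where "A f = T f - t *\<^sub>R f" for f
  \<comment> \<open>The maximum with \<open>gam\<close> ensures \<open>gam / M \<le> 1\<close>, so
    that the contraction factor \<open>\<rho>\<close> is nonnegative.\<close>
  define M where "M = max (H + \<bar>t\<bar>) gam"
  define \<rho> where "\<rho> = 1 - (gam / M)\<^sup>2"
  have M: "M > 0" "gam \<le> M" using gam by (auto simp: M_def)
  have \<rho>: "0 \<le> \<rho>" "\<rho> < 1"
    using M gam by (auto simp: \<rho>_def power_le_one)
  have A_lin: "A (f + g) = A f + A g" "A (c *\<^sub>R f) = c *\<^sub>R A f" "A (f - g) = A f - A g" for f g c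
    by (simp_all add: A_def T_simps algebra_simps)
  have A_sym: "ip (A f) g = ip f (A g)" for f g
    by (simp add: A_def ip_simps T_sym)
  have A_bound: "q (A f) \<le> M * q f" for f
  proof -
    have "q (A f) \<le> q (T f) + \<bar>t\<bar> * q f"
      unfolding A_def using q_triangle_diff[of "T f" "t *\<^sub>R f"] by (simp add: q_scale)
    also have "\<dots> \<le> (H + \<bar>t\<bar>) * q f"
      using T_q_bound[of f] by (simp add: algebra_simps)
    also have "\<dots> \<le> M * q f" by (intro mult_right_mono) (auto simp: M_def)
    finally show ?thesis .
  qed
  \<comment> \<open>With \<open>A\<close> symmetric, the cross term is
    \<open>- 2 (q (A e) / M)\<^sup>2\<close>, and the last square is at most
    \<open>(q (A e) / M)\<^sup>2\<close>; half of the gain survives and \<open>lower\<close> makes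
    it proportional to \<open>q e\<close>.\<close>
  have step: "(q (e - (1 / M\<^sup>2) *\<^sub>R A (A e)))\<^sup>2 \<le> \<rho> * (q e)\<^sup>2" for e
  proof -
    have "(q (e - (1 / M\<^sup>2) *\<^sub>R A (A e)))\<^sup>2
        = (q e)\<^sup>2 - 2 * (1 / M\<^sup>2) * (q (A e))\<^sup>2 + (1 / M\<^sup>2)\<^sup>2 * (q (A (A e)))\<^sup>2"
      unfolding q_square by (simp add: ip_simps A_sym[symmetric, of e] ip_sym[of "A (A e)" e]
          algebra_simps power2_eq_square)
    also have "\<dots> \<le> (q e)\<^sup>2 - 2 * (1 / M\<^sup>2) * (q (A e))\<^sup>2 + (1 / M\<^sup>2)\<^sup>2 * (M * q (A e))\<^sup>2"
      by (intro add_left_mono mult_left_mono power_mono A_bound) auto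
    also have "\<dots> = (q e)\<^sup>2 - (q (A e) / M)\<^sup>2"
      using M by (simp add: field_simps power2_eq_square)
    also have "\<dots> \<le> (q e)\<^sup>2 - (gam * q e / M)\<^sup>2"
    proof -
      have "(gam * q e / M)\<^sup>2 \<le> (q (A e) / M)\<^sup>2"
        using lower[of e] M gam by (intro power_mono divide_right_mono) (auto simp: A_def)
      then show ?thesis by simp
    qed
    also have "\<dots> = \<rho> * (q e)\<^sup>2" by (simp add: \<rho>_def power_mult_distrib power_divide algebra_simps)
    finally show ?thesis .
  qed
  have approx: "\<exists>w. (q (f - A w))\<^sup>2 \<le> \<rho> ^ n * (q f)\<^sup>2" for f n
  proof (induction n)
    case 0
    have "A 0 = 0" by (simp add: A_def T_simps)
    then show ?case by (intro exI[of _ 0]) simp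
  next
    case (Suc n)
    then obtain w where w: "(q (f - A w))\<^sup>2 \<le> \<rho> ^ n * (q f)\<^sup>2" by blast
    define e where "e = f - A w"
    have "f - A (w + (1 / M\<^sup>2) *\<^sub>R A e) = e - (1 / M\<^sup>2) *\<^sub>R A (A e)"
      by (simp add: A_lin e_def)
    then have "(q (f - A (w + (1 / M\<^sup>2) *\<^sub>R A e)))\<^sup>2 \<le> \<rho> * (q e)\<^sup>2"
      using step[of e] by simp
    also have "\<dots> \<le> \<rho> * (\<rho> ^ n * (q f)\<^sup>2)"
      using w \<rho> by (intro mult_left_mono) (auto simp: e_def)
    finally show ?case by (auto simp: mult.assoc)
  qed
  have surj: "\<exists>w. A w = f" for f
  proof -
    obtain w where w: "\<And>n. (q (f - A (w n)))\<^sup>2 \<le> \<rho> ^ n * (q f)\<^sup>2"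
      using approx[of f] by metis
    have "(\<lambda>n. \<rho> ^ n * (q f)\<^sup>2) \<longlonglongrightarrow> 0"
      using \<rho> by (intro tendsto_mult_left_zero LIMSEQ_realpow_zero) auto
    then have "(\<lambda>n. (q (f - A (w n)))\<^sup>2) \<longlonglongrightarrow> 0"
      by (rule Lim_null_comparison[rotated]) (use w in auto)
    then have "(\<lambda>n. sqrt ((q (f - A (w n)))\<^sup>2)) \<longlonglongrightarrow> sqrt 0" by (rule tendsto_real_sqrt)
    then have lim: "(\<lambda>n. q (f - A (w n))) \<longlonglongrightarrow> 0" by simp
    have "Cauchy (\<lambda>n. T (w n))"
    proof (rule metric_CauchyI)
      fix \<epsilon> :: real assume \<epsilon>: "\<epsilon> > 0"
      define \<eta> where "\<eta> = \<epsilon> * gam / (2 * H)"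
      have "\<eta> > 0" using \<epsilon> gam H_pos by (simp add: \<eta>_def)
      then obtain N where N: "\<And>n. n \<ge> N \<Longrightarrow> q (f - A (w n)) < \<eta>"
        using LIMSEQ_D[OF lim, of \<eta>] by auto
      have "dist (T (w m)) (T (w n)) < \<epsilon>" if mn: "m \<ge> N" "n \<ge> N" for m n
      proof -
        have "gam * q (w m - w n) \<le> q (A (w m) - A (w n))"
          using lower[of "w m - w n"] by (simp add: A_lin flip: A_def)
        also have "\<dots> = q ((f - A (w n)) - (f - A (w m)))" by simp
        also have "\<dots> \<le> q (f - A (w n)) + q (f - A (w m))" by (rule q_triangle_diff)
        also have "\<dots> < 2 * \<eta>" using N[OF mn(1)] N[OF mn(2)] by simp
        finally have "q (w m - w n) < \<epsilon> / H" using gam H_pos by (simp add: \<eta>_def field_simps)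
        then have "H * q (w m - w n) < \<epsilon>" using H_pos by (simp add: field_simps)
        then show ?thesis using T_bound[of "w m - w n"] by (simp add: dist_norm T_simps)
      qed
      then show "\<exists>N. \<forall>m\<ge>N. \<forall>n\<ge>N. dist (T (w m)) (T (w n)) < \<epsilon>" by blast
    qed
    then obtain g where g: "(\<lambda>n. T (w n)) \<longlonglongrightarrow> g"
      using Cauchy_convergent convergent_def by blast
    \<comment> \<open>Since \<open>t w = T w - A w\<close>, the limits \<open>g\<close> of
      \<open>T (w n)\<close> and \<open>f\<close> of \<open>A (w n)\<close> force the limit of
      \<open>w n\<close> to be \<open>(g - f) / t\<close>.\<close>
    define v where "v = (1 / t) *\<^sub>R (g - f)"
    have tv: "t *\<^sub>R v = g - f" using t by (simp add: v_def)
    have "(\<lambda>n. q (w n - v)) \<longlonglongrightarrow> 0"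
    proof (rule Lim_null_comparison)
      show "\<forall>\<^sub>F n in sequentially. norm (q (w n - v)) \<le> (1 / \<bar>t\<bar>) * (q (T (w n) - g) + q (f - A (w n)))"
      proof (rule always_eventually, rule allI)
        fix n
        have "t *\<^sub>R (w n - v) = (T (w n) - g) + (f - A (w n))"
          using tv by (simp add: A_def algebra_simps)
        then have "\<bar>t\<bar> * q (w n - v) = q ((T (w n) - g) + (f - A (w n)))"
          using q_scale[of t "w n - v"] by simp
        also have "\<dots> \<le> q (T (w n) - g) + q (f - A (w n))" by (rule q_triangle)
        finally show "norm (q (w n - v)) \<le> (1 / \<bar>t\<bar>) * (q (T (w n) - g) + q (f - A (w n)))"
          using t by (simp add: field_simps)
      qed
      show "(\<lambda>n. (1 / \<bar>t\<bar>) * (q (T (w n) - g) + q (f - A (w n)))) \<longlonglongrightarrow> 0"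
        using tendsto_mult_left[OF tendsto_add[OF tendsto_norm_imp_q[OF g] lim], of "1 / \<bar>t\<bar>"] by simp
    qed
    then have "g = T v" using LIMSEQ_unique[OF g T_tendsto_q] by blast
    then have "A v = f" using tv by (simp add: A_def)
    then show ?thesis ..
  qed
  \<comment> \<open>The lower bound is only for \<open>q\<close>; writing
    \<open>t f = T f - A f\<close> and smoothing the first term lifts it to the norm. It yields both
    injectivity and boundedness of the inverse.\<close>
  have bound: "norm f \<le> norm (A f) * ((H / gam + 1) / \<bar>t\<bar>)" for f
  proof -
    have "t *\<^sub>R f = T f - A f" by (simp add: A_def)
    then have "\<bar>t\<bar> * norm f = norm (T f - A f)" by (metis norm_scaleR)
    also have "\<dots> \<le> norm (T f) + norm (A f)" by (rule norm_triangle_ineq4)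
    also have "norm (T f) \<le> H * (norm (A f) / gam)"
    proof -
      have "q f \<le> norm (A f) / gam"
        using lower[of f] q_le_norm[of "A f"] gam by (simp add: field_simps A_def)
      then show ?thesis using T_bound[of f] H_pos by (meson mult_left_mono less_imp_le order_trans)
    qed
    finally show ?thesis using t by (simp add: field_simps)
  qed
  have inj: "f = g" if "A f = A g" for f g
    using bound[of "f - g"] that by (simp add: A_lin)
  obtain R where R: "\<And>f. A (R f) = f" using surj by metis
  have "bounded_linear R"
  proof (rule bounded_linear_intro)
    show "R (f + g) = R f + R g" "R (c *\<^sub>R f) = c *\<^sub>R R f" for f g c
      by (rule inj; simp add: A_lin R)+
    show "norm (R f) \<le> norm f * ((H / gam + 1) / \<bar>t\<bar>)" for f
      using bound[of "R f"] by (simp add: R)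
  qed
  moreover have "R (A f) = f" for f by (rule inj) (simp add: R)
  ultimately show ?thesis
    using R unfolding spectrum_def A_def by blast
qed

text \<open>\<open>T - t\<close> respects the splitting into the line of \<open>u\<close> and its
  complement: on the line it is the factor \<open>lam - t\<close>, on the complement it is bounded
  below by \<open>gam - |t - lam|\<close>. If both were nonzero, \<open>t\<close> would lie outside
  the spectrum.\<close>

lemma isolated_in_spectrum:
  assumes lam: "lam \<noteq> 0" and u: "T u = lam *\<^sub>R u" "u \<noteq> 0" and gam: "gam > 0"
    and gap: "\<And>w. ip w u = 0 \<Longrightarrow> gam * q w \<le> q (T w - lam *\<^sub>R w)"
    and t: "t \<in> spectrum T" "t \<noteq> 0" "t \<noteq> lam"
  shows "gam \<le> \<bar>t - lam\<bar>"
proof (rule ccontr)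
  assume "\<not> gam \<le> \<bar>t - lam\<bar>"
  define \<delta> where "\<delta> = min \<bar>t - lam\<bar> (gam - \<bar>t - lam\<bar>)"
  have \<delta>: "\<delta> > 0" "\<delta> \<le> \<bar>t - lam\<bar>" "\<delta> \<le> gam - \<bar>t - lam\<bar>"
    using t \<open>\<not> gam \<le> \<bar>t - lam\<bar>\<close> by (auto simp: \<delta>_def)
  have qu: "ip u u > 0"
    using q_eigenvector_pos(2)[OF u(1) lam u(2)] q_square[of u] by (metis zero_less_power)
  have "\<delta> * q f \<le> q (T f - t *\<^sub>R f)" for f
  proof -
    define c where "c = ip f u / ip u u"
    define w where "w = f - c *\<^sub>R u"
    have w: "ip w u = 0" "ip u w = 0"
      using qu ip_sym[of u w] by (simp_all add: w_def c_def ip_simps)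
    have f: "f = c *\<^sub>R u + w" by (simp add: w_def)
    define z where "z = T w - t *\<^sub>R w"
    have z: "ip z u = 0" "ip u z = 0"
      using w ip_sym[of u z] by (simp_all add: z_def ip_simps T_sym u)
    have "gam * q w \<le> q (z + (t - lam) *\<^sub>R w)"
      using gap[OF w(1)] by (simp add: z_def algebra_simps)
    also have "\<dots> \<le> q z + \<bar>t - lam\<bar> * q w" using q_triangle[of z "(t - lam) *\<^sub>R w"] by (simp add: q_scale)
    finally have "(gam - \<bar>t - lam\<bar>) * q w \<le> q z" by (simp add: algebra_simps)
    moreover have "\<delta> * q w \<le> (gam - \<bar>t - lam\<bar>) * q w" by (intro mult_right_mono \<delta>) simp
    ultimately have "\<delta> * q w \<le> q z" by simp
    then have "(\<delta> * q w)\<^sup>2 \<le> (q z)\<^sup>2" using \<delta> by (intro power_mono) auto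
    then have 1: "\<delta>\<^sup>2 * ip w w \<le> ip z z" by (simp add: power_mult_distrib q_square)
    have "\<delta>\<^sup>2 \<le> \<bar>t - lam\<bar>\<^sup>2" using \<delta> by (intro power_mono) auto
    then have 2: "\<delta>\<^sup>2 * (c\<^sup>2 * ip u u) \<le> (lam - t)\<^sup>2 * (c\<^sup>2 * ip u u)"
      using qu by (intro mult_right_mono) (auto simp: power2_commute)
    have "T f - t *\<^sub>R f = ((lam - t) * c) *\<^sub>R u + z"
      by (simp add: f z_def T_simps u algebra_simps)
    then have "(q (T f - t *\<^sub>R f))\<^sup>2 = ip (((lam - t) * c) *\<^sub>R u + z) (((lam - t) * c) *\<^sub>R u + z)"
      by (simp only: q_square)
    also have "\<dots> = (lam - t)\<^sup>2 * (c\<^sup>2 * ip u u) + ip z z"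
      by (simp add: ip_simps z power2_eq_square)
    finally have "(q (T f - t *\<^sub>R f))\<^sup>2 = (lam - t)\<^sup>2 * (c\<^sup>2 * ip u u) + ip z z" .
    moreover have "(\<delta> * q f)\<^sup>2 = \<delta>\<^sup>2 * (c\<^sup>2 * ip u u) + \<delta>\<^sup>2 * ip w w"
      unfolding power_mult_distrib q_square f by (simp add: ip_simps w power2_eq_square algebra_simps)
    ultimately have "(\<delta> * q f)\<^sup>2 \<le> (q (T f - t *\<^sub>R f))\<^sup>2" using 1 2 by simp
    then show ?thesis by (rule power2_le_imp_le) simp
  qed
  then have "t \<notin> spectrum T" using not_in_spectrum[OF t(2) \<delta>(1)] by blast
  then show False using t by blast
qed

section \<open>From a small residual to a nearby eigenvector\<close>

text \<open>On the orthogonal complement of \<open>u\<close> the component \<open>w\<close> of \<open>v\<close> satisfies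
  \<open>(T - \<mu>) w = r\<^sup>\<bottom>\<close>, so that no convergence rate for \<open>\<mu> - \<lambda>\<close> is needed.\<close>

lemma eigenvector_perturbation:
  assumes lam: "lam \<noteq> 0" and u: "T u = lam *\<^sub>R u" "norm u = 1"
    and \<delta>: "\<delta> > 0" "\<delta> \<le> \<bar>lam\<bar>"
    and gap: "\<And>w. ip w u = 0 \<Longrightarrow> \<delta> * q w \<le> q (T w - lam *\<^sub>R w)"
    and \<mu>: "\<bar>\<mu> - lam\<bar> \<le> \<delta> / 2" and v: "norm v = 1"
  shows "\<exists>a\<in>{1, -1}. norm (a *\<^sub>R v - u)
    \<le> 4 / \<bar>lam\<bar> * (2 * H / \<delta> + 1 + H / \<bar>lam\<bar>) * norm (T v - \<mu> *\<^sub>R v)"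
proof -
  define r where "r = T v - \<mu> *\<^sub>R v"
  have u0: "u \<noteq> 0" using u by auto
  have qu: "\<bar>lam\<bar> \<le> H * q u" "q u > 0" using q_eigenvector_pos[OF u(1) lam u0] u(2) by auto
  have ipu: "ip u u > 0" using qu(2) q_square[of u] by (metis zero_less_power)
  define c where "c = ip v u / ip u u"
  define w where "w = v - c *\<^sub>R u"
  define b where "b = ip r u / ip u u"
  define r' where "r' = r - b *\<^sub>R u"
  have w: "ip w u = 0" using ipu by (simp add: w_def c_def ip_simps)
  have r'u: "ip r' u = 0" using ipu by (simp add: r'_def b_def ip_simps)
  \<comment> \<open>By symmetry the \<open>u\<close>-component of the residual carries all of
    \<open>lam - \<mu>\<close>; removing it leaves the exact equation for \<open>w\<close>.\<close>
  have "b = (lam - \<mu>) * c"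
  proof -
    have "ip r u = (lam - \<mu>) * ip v u" by (simp add: r_def ip_simps T_sym u algebra_simps)
    then show ?thesis by (simp add: b_def c_def)
  qed
  then have "b *\<^sub>R u = (lam * c) *\<^sub>R u - (\<mu> * c) *\<^sub>R u"
    by (simp add: left_diff_distrib scaleR_diff_left)
  then have Tw: "T w - \<mu> *\<^sub>R w = r'"
    by (simp add: w_def r'_def r_def T_simps u algebra_simps)
  have "(q r)\<^sup>2 = (q r')\<^sup>2 + (b * q u)\<^sup>2"
  proof -
    have r: "r = r' + b *\<^sub>R u" by (simp add: r'_def)
    show ?thesis
      unfolding power_mult_distrib q_square r using r'u ip_sym[of u r']
      by (simp add: ip_simps power2_eq_square)
  qed
  then have "(q r')\<^sup>2 \<le> (q r)\<^sup>2" by simp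
  then have qr': "q r' \<le> norm r" using q_le_norm[of r] power2_le_imp_le q_nonneg order_trans by meson
  \<comment> \<open>\<open>(T - lam) w\<close> is \<open>r' + (\<mu> - lam) w\<close>. The second
    term costs at most half of the gap and is absorbed, whence the factor
    \<open>2 / \<delta>\<close>.\<close>
  have "\<delta> * q w \<le> q (r' + (\<mu> - lam) *\<^sub>R w)"
    using gap[OF w] by (simp add: algebra_simps flip: Tw)
  also have "\<dots> \<le> q r' + \<bar>\<mu> - lam\<bar> * q w"
    using q_triangle[of r' "(\<mu> - lam) *\<^sub>R w"] by (simp add: q_scale)
  also have "\<dots> \<le> norm r + \<delta> / 2 * q w"
    using qr' \<mu> by (intro add_mono mult_right_mono) auto
  finally have qw: "q w \<le> 2 / \<delta> * norm r" using \<delta> by (simp add: field_simps)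
  have br: "\<bar>b\<bar> \<le> H / \<bar>lam\<bar> * norm r"
  proof -
    have "\<bar>b\<bar> * (q u)\<^sup>2 = \<bar>ip r u\<bar>" using ipu by (simp add: b_def q_square abs_mult)
    also have "\<dots> \<le> q r * q u" by (rule Cauchy_Schwarz)
    finally have "\<bar>b\<bar> * q u \<le> q r" using qu(2) by (simp add: power2_eq_square)
    then have 1: "H * (\<bar>b\<bar> * q u) \<le> H * norm r"
      using q_le_norm[of r] H_pos by (intro mult_left_mono) auto
    have "\<bar>b\<bar> * \<bar>lam\<bar> \<le> \<bar>b\<bar> * (H * q u)" using qu by (intro mult_left_mono) auto
    then show ?thesis using 1 lam by (simp add: field_simps)
  qed
  have "norm r' \<le> norm r + \<bar>b\<bar>"
    using norm_triangle_ineq4[of r "b *\<^sub>R u"] u by (simp add: r'_def)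
  then have nr': "norm r' \<le> (1 + H / \<bar>lam\<bar>) * norm r" using br by (simp add: algebra_simps)
  have \<mu>lam: "\<bar>lam\<bar> / 2 \<le> \<bar>\<mu>\<bar>" using \<mu> \<delta> by linarith
  have "\<bar>\<mu>\<bar> * norm w = norm (T w - r')" by (simp flip: Tw)
  also have "\<dots> \<le> norm (T w) + norm r'" by (rule norm_triangle_ineq4)
  also have "\<dots> \<le> H * (2 / \<delta> * norm r) + (1 + H / \<bar>lam\<bar>) * norm r"
    using nr' T_bound[of w] mult_left_mono[OF qw, of H] H_pos by simp
  also have "\<dots> = (2 * H / \<delta> + 1 + H / \<bar>lam\<bar>) * norm r" by (simp add: algebra_simps)
  finally have "\<bar>\<mu>\<bar> * norm w \<le> (2 * H / \<delta> + 1 + H / \<bar>lam\<bar>) * norm r" .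
  moreover have "\<bar>lam\<bar> / 2 * norm w \<le> \<bar>\<mu>\<bar> * norm w" using \<mu>lam by (intro mult_right_mono) auto
  ultimately have "\<bar>lam\<bar> / 2 * norm w \<le> (2 * H / \<delta> + 1 + H / \<bar>lam\<bar>) * norm r"
    by (rule order_trans[rotated])
  then have "4 / \<bar>lam\<bar> * (\<bar>lam\<bar> / 2 * norm w) \<le> 4 / \<bar>lam\<bar> * ((2 * H / \<delta> + 1 + H / \<bar>lam\<bar>) * norm r)"
    by (rule mult_left_mono) simp
  also have "4 / \<bar>lam\<bar> * (\<bar>lam\<bar> / 2 * norm w) = 2 * norm w" using lam by simp
  finally have nw: "2 * norm w \<le> 4 / \<bar>lam\<bar> * (2 * H / \<delta> + 1 + H / \<bar>lam\<bar>) * norm r"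
    by (simp only: mult.assoc)
  \<comment> \<open>With \<open>a c = |c|\<close> the error is \<open>(|c| - 1) u + a w\<close>, and
    \<open>| |c| - 1 |\<close> is at most \<open>norm w\<close> because \<open>u\<close> and
    \<open>v\<close> are unit vectors. This doubling and \<open>|\<mu>| \<ge> |lam| / 2\<close>
    produce the \<open>4 / |lam|\<close>.\<close>
  define a :: real where "a = (if c \<ge> 0 then 1 else -1)"
  have a: "a \<in> {1, -1}" "a * c = \<bar>c\<bar>" "\<bar>a\<bar> = 1" by (auto simp: a_def)
  have vw: "v = c *\<^sub>R u + w" by (simp add: w_def)
  have "\<bar>\<bar>c\<bar> - 1\<bar> \<le> norm w"
    using norm_triangle_ineq3[of "c *\<^sub>R u" v] u v by (simp add: w_def norm_minus_commute)
  moreover have "a *\<^sub>R v - u = (\<bar>c\<bar> - 1) *\<^sub>R u + a *\<^sub>R w"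
    by (simp add: vw algebra_simps flip: a(2))
  then have "norm (a *\<^sub>R v - u) \<le> \<bar>\<bar>c\<bar> - 1\<bar> + norm w"
    using norm_triangle_ineq[of "(\<bar>c\<bar> - 1) *\<^sub>R u" "a *\<^sub>R w"] u a(3) by simp
  ultimately have "norm (a *\<^sub>R v - u) \<le> 2 * norm w" by simp
  then show ?thesis using nw a(1) unfolding r_def by (intro bexI[of _ a]) auto
qed

end

section \<open>Integral operators with continuous kernels\<close>

text \<open>The centres of finite nets of radius \<open>1 / Suc n\<close>, enumerated. They serve
  both the measurability on the product and the diagonal subsequence for compactness.\<close>

lemma compact_imp_dense_sequence:
  assumes "compact (UNIV :: 'a::metric_space set)"
  obtains d :: "nat \<Rightarrow> 'a::metric_space" where "\<And>x e. e > 0 \<Longrightarrow> \<exists>n. dist x (d n) < e"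
proof -
  have "\<exists>K. finite K \<and> (UNIV :: 'a set) \<subseteq> (\<Union>x\<in>K. ball x (1 / Suc n))" for n :: nat
  proof -
    have "\<forall>e>0. \<exists>K. finite K \<and> (UNIV :: 'a set) \<subseteq> (\<Union>x\<in>K. ball x e)"
      using assms unfolding compact_eq_totally_bounded by (rule conjunct2)
    then show ?thesis by (rule allE[of _ "1 / Suc n"]) simp
  qed
  then obtain K :: "nat \<Rightarrow> 'a set"
    where K: "\<And>n. finite (K n)" "\<And>n. UNIV \<subseteq> (\<Union>x\<in>K n. ball x (1 / Suc n))"
    by metis
  define D where "D = (\<Union>n. K n)"
  have "countable D" unfolding D_def using K(1) by (intro countable_UN) (auto intro: countable_finite)
  moreover have "D \<noteq> {}" using K(2)[of 0] by (fastforce simp: D_def)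
  ultimately have D: "range (from_nat_into D) = D" by (intro range_from_nat_into)
  have "\<exists>n. dist x (from_nat_into D n) < e" if "e > 0" for x e
  proof -
    obtain n where n: "1 / Suc n < e" using \<open>e > 0\<close> nat_approx_posE by blast
    obtain y where "y \<in> K n" "dist y x < 1 / Suc n" using K(2)[of n] by (auto simp: subset_iff)
    then have "y \<in> range (from_nat_into D)" "dist x y < e"
      unfolding D using n by (auto simp: D_def dist_commute)
    then show ?thesis by blast
  qed
  then show thesis using that by blast
qed

lemma continuous_on_arguments:
  assumes "continuous_on UNIV (\<lambda>(x, y). F x y)"
  shows "continuous_on UNIV (F x)" "continuous_on UNIV (\<lambda>x. F x y)"
proof -
  show "continuous_on UNIV (F x)"
    using continuous_on_compose2[OF assms, of UNIV "\<lambda>y. (x, y)"] by (simp add: continuous_on_Pair)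
  show "continuous_on UNIV (\<lambda>x. F x y)"
    using continuous_on_compose2[OF assms, of UNIV "\<lambda>x. (x, y)"] by (simp add: continuous_on_Pair)
qed

lemma continuous_on_pair_projections:
  assumes "continuous_on UNIV f"
  shows "continuous_on UNIV (\<lambda>(x, y). f x)" "continuous_on UNIV (\<lambda>(x, y). f y)"
  by (simp_all add: case_prod_unfold continuous_on_compose2[OF assms] continuous_on_fst continuous_on_snd
      continuous_on_id)

text \<open>The common setting of the population measure and of the empirical measures.\<close>

locale compact_prob_space = prob_space Q for Q :: "'a::metric_space measure" +
  assumes compact: "compact (UNIV :: 'a set)" and sets: "sets Q = sets borel"
begin

lemma continuous_measurable:
  fixes f :: "'a \<Rightarrow> real"
  assumes "continuous_on UNIV f" shows "f \<in> borel_measurable Q"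
  using borel_measurable_continuous_onI[OF assms] sets by (simp cong: measurable_cong_sets)

lemma continuous_integrable:
  fixes f :: "'a \<Rightarrow> real"
  assumes "continuous_on UNIV f" shows "integrable Q f"
proof -
  obtain C where "\<And>x. norm (f x) \<le> C"
    using compact_continuous_image[OF assms compact] by (force dest!: compact_imp_bounded simp: bounded_iff)
  then show ?thesis
    using continuous_measurable[OF assms] by (intro integrable_const_bound[where B = C]) auto
qed

lemma integral_bound:
  fixes f :: "'a \<Rightarrow> real"
  assumes "continuous_on UNIV f" "\<And>x. \<bar>f x\<bar> \<le> C" shows "\<bar>\<integral>x. f x \<partial>Q\<bar> \<le> C"
proof -
  have i: "integrable Q (\<lambda>x. \<bar>f x\<bar>)" using continuous_integrable[OF assms(1)] by simp
  have "\<bar>\<integral>x. f x \<partial>Q\<bar> \<le> (\<integral>x. \<bar>f x\<bar> \<partial>Q)" by (rule integral_abs_bound)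
  also have "\<dots> \<le> (\<integral>x. C \<partial>Q)" using assms(2) by (intro integral_mono i) auto
  finally show ?thesis by (simp add: prob_space)
qed

end

text \<open>The Borel sets of \<open>'a \<times> 'a\<close> are not known to be generated by rectangles here, as \<open>'a\<close> is
  not an instance of \<^class>\<open>second_countable_topology\<close>. So the first argument is
  discretized along a dense sequence.\<close>

lemma continuous_pair_measurable:
  fixes F :: "'a::metric_space \<Rightarrow> 'a \<Rightarrow> real"
  assumes "compact_prob_space P" "compact_prob_space Q" and F: "continuous_on UNIV (\<lambda>(x, y). F x y)"
  shows "(\<lambda>(x, y). F x y) \<in> borel_measurable (P \<Otimes>\<^sub>M Q)"
proof -
  interpret P: compact_prob_space P by fact
  interpret Q: compact_prob_space Q by fact
  obtain d :: "nat \<Rightarrow> 'a" where d: "\<And>x e. e > 0 \<Longrightarrow> \<exists>n. dist x (d n) < e"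
    using compact_imp_dense_sequence[OF P.compact] by blast
  \<comment> \<open>The index of the first \<open>d j\<close> within \<open>1 / Suc m\<close> of
    \<open>x\<close>. It takes countably many values, so freezing the first argument at
    \<open>d (i m x)\<close> gives a measurable function, which tends to \<open>F\<close> by
    continuity.\<close>
  define i where "i m x = (LEAST j. dist x (d j) < 1 / Suc m)" for m x
  have i: "dist x (d (i m x)) < 1 / Suc m" for m x
    unfolding i_def using LeastI_ex[OF d[of "1 / Suc m" x]] by simp
  have [measurable]: "i m \<in> measurable P (count_space UNIV)" for m
  proof -
    have "Measurable.pred P (\<lambda>x. dist x (d j) < 1 / Suc m)" for j
    proof -
      have "open {x. dist x (d j) < 1 / Suc m}"
        using open_ball[of "d j" "1 / Suc m"] by (simp add: ball_def dist_commute)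
      then have "{x. dist x (d j) < 1 / Suc m} \<in> sets P" by (simp add: P.sets)
      moreover have "space P = UNIV" using sets_eq_imp_space_eq[OF P.sets] by simp
      ultimately show ?thesis by (simp add: pred_def)
    qed
    then show ?thesis unfolding i_def by (rule measurable_Least)
  qed
  have [measurable]: "F x \<in> borel_measurable Q" for x
    by (rule Q.continuous_measurable[OF continuous_on_arguments(1)[OF F]])
  have "(\<lambda>p. F (d (i m (fst p))) (snd p)) \<in> borel_measurable (P \<Otimes>\<^sub>M Q)" for m
    by (rule measurable_compose_countable[where f = "\<lambda>j p. F (d j) (snd p)" and g = "\<lambda>p. i m (fst p)"])
      measurable
  then have "(\<lambda>p. F (fst p) (snd p)) \<in> borel_measurable (P \<Otimes>\<^sub>M Q)"
  proof (rule borel_measurable_LIMSEQ_metric)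
    fix p :: "'a \<times> 'a"
    have "(\<lambda>m. d (i m (fst p))) \<longlonglongrightarrow> fst p"
    proof (rule metric_LIMSEQ_I)
      fix e :: real assume "e > 0"
      then obtain N where N: "1 / Suc N < e" using nat_approx_posE by blast
      have "dist (d (i m (fst p))) (fst p) < e" if "m \<ge> N" for m
      proof -
        have "1 / real (Suc m) \<le> 1 / Suc N" using that by (simp add: frac_le)
        then show ?thesis using i[of "fst p" m] N by (simp add: dist_commute)
      qed
      then show "\<exists>N. \<forall>m\<ge>N. dist (d (i m (fst p))) (fst p) < e" by blast
    qed
    then show "(\<lambda>m. F (d (i m (fst p))) (snd p)) \<longlonglongrightarrow> F (fst p) (snd p)"
      using continuous_on_arguments(2)[OF F, of "snd p"]
      by (auto simp: continuous_on_sequentially o_def)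
  qed
  then show ?thesis by (simp add: case_prod_unfold)
qed

lemma continuous_pair_bounded:
  fixes F :: "'a::metric_space \<Rightarrow> 'a \<Rightarrow> real"
  assumes "compact (UNIV :: 'a set)" "continuous_on UNIV (\<lambda>(x, y). F x y)"
  obtains C where "\<And>x y. \<bar>F x y\<bar> \<le> C"
proof -
  have "compact ((\<lambda>(x, y). F x y) ` (UNIV \<times> UNIV))"
    using assms by (intro compact_continuous_image compact_Times) auto
  then show thesis using that by (force dest!: compact_imp_bounded simp: bounded_iff)
qed

lemma continuous_Fubini:
  fixes F :: "'a::metric_space \<Rightarrow> 'a \<Rightarrow> real"
  assumes P: "compact_prob_space P" and Q: "compact_prob_space Q"
    and F: "continuous_on UNIV (\<lambda>(x, y). F x y)"
  shows "(\<integral>x. (\<integral>y. F x y \<partial>Q) \<partial>P) = (\<integral>y. (\<integral>x. F x y \<partial>P) \<partial>Q)"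
proof -
  interpret P: compact_prob_space P by fact
  interpret Q: compact_prob_space Q by fact
  interpret PQ: pair_prob_space P Q ..
  obtain C where "\<And>x y. \<bar>F x y\<bar> \<le> C"
    using continuous_pair_bounded[OF P.compact F] by blast
  then have "integrable (P \<Otimes>\<^sub>M Q) (\<lambda>(x, y). F x y)"
    using continuous_pair_measurable[OF P Q F]
    by (intro PQ.P.integrable_const_bound[where B = C]) auto
  from PQ.Fubini_integral[OF this] show ?thesis by simp
qed

context compact_prob_space
begin

section \<open>The L2 inner product and compactness of kernel operators\<close>

lemma semi_inner_L2: "semi_inner (\<lambda>(f :: 'a \<Rightarrow>\<^sub>C real) (g :: 'a \<Rightarrow>\<^sub>C real). \<integral>y. f y * g y \<partial>Q)"
proof
  fix f g h :: "'a \<Rightarrow>\<^sub>C real" and c :: real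
  have int: "integrable Q (\<lambda>y. f y * g y)" for f g :: "'a \<Rightarrow>\<^sub>C real"
    by (intro continuous_integrable continuous_intros) auto
  show "(\<integral>y. (f + g) y * h y \<partial>Q) = (\<integral>y. f y * h y \<partial>Q) + (\<integral>y. g y * h y \<partial>Q)"
    by (simp add: distrib_right int)
  show "(\<integral>y. (c *\<^sub>R f) y * g y \<partial>Q) = c * (\<integral>y. f y * g y \<partial>Q)"
    by (simp add: mult.assoc)
  show "(\<integral>y. f y * g y \<partial>Q) = (\<integral>y. g y * f y \<partial>Q)"
    by (simp add: mult.commute)
  show "0 \<le> (\<integral>y. f y * f y \<partial>Q)" by simp
  have "\<bar>f y * f y\<bar> \<le> (norm f)\<^sup>2" for y
    using mult_mono[OF norm_bounded[of f y] norm_bounded[of f y]] by (simp add: power2_eq_square)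
  then have "\<bar>\<integral>y. f y * f y \<partial>Q\<bar> \<le> (norm f)\<^sup>2"
    by (intro integral_bound continuous_intros) auto
  then show "(\<integral>y. f y * f y \<partial>Q) \<le> (norm f)\<^sup>2" by simp
qed

text \<open>\<open>T f x\<close> is the inner product of \<open>f\<close> with the kernel section
  \<open>\<kappa> x\<close>, so Cauchy-Schwarz gives the sup bound as well as equicontinuity; Fubini
  gives symmetry.\<close>

lemma smoothing_operator_kernel:
  fixes h :: "'a \<Rightarrow> 'a \<Rightarrow> real" and T :: "('a \<Rightarrow>\<^sub>C real) \<Rightarrow> ('a \<Rightarrow>\<^sub>C real)"
  assumes h: "continuous_on UNIV (\<lambda>(x, y). h x y)" "\<And>x y. h x y = h y x"
    and H: "\<And>x y. \<bar>h x y\<bar> \<le> H" "0 < H"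
    and T: "\<And>f x. T f x = (\<integral>y. h x y * f y \<partial>Q)"
  shows "smoothing_operator (\<lambda>(f :: 'a \<Rightarrow>\<^sub>C real) (g :: 'a \<Rightarrow>\<^sub>C real). \<integral>y. f y * g y \<partial>Q) T H"
proof -
  define ip where "ip = (\<lambda>(f :: 'a \<Rightarrow>\<^sub>C real) (g :: 'a \<Rightarrow>\<^sub>C real). \<integral>y. f y * g y \<partial>Q)"
  interpret semi_inner ip unfolding ip_def by (rule semi_inner_L2)
  have cont: "continuous_on UNIV (h x)" for x
    by (rule continuous_on_arguments[OF h(1)])
  define \<kappa> where "\<kappa> x = Bcontfun (h x)" for x
  have \<kappa>: "apply_bcontfun (\<kappa> x) = h x" for x
    unfolding \<kappa>_def using cont H(1) by (intro Bcontfun_inverse bcontfun_normI) auto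
  have T\<kappa>: "T f x = ip (\<kappa> x) f" for f x
    by (simp add: T ip_def \<kappa>)
  have n\<kappa>: "norm (\<kappa> x) \<le> H" for x
    by (rule norm_bound) (simp add: \<kappa> H)
  have Tx: "\<bar>T f x\<bar> \<le> H * q f" for f x
    unfolding T\<kappa> using Cauchy_Schwarz[of "\<kappa> x" f] q_le_norm[of "\<kappa> x"] n\<kappa>[of x]
      mult_right_mono[of "q (\<kappa> x)" H "q f"] by simp
  have equi: "\<exists>\<delta>>0. \<forall>x y. dist x y < \<delta> \<longrightarrow> (\<forall>f. \<bar>T f x - T f y\<bar> \<le> \<eta> * q f)" if \<eta>: "\<eta> > 0" for \<eta>
  proof -
    have "compact (UNIV \<times> UNIV :: ('a \<times> 'a) set)" by (intro compact_Times compact)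
    then have "uniformly_continuous_on UNIV (\<lambda>(x, y). h x y)"
      using compact_uniformly_continuous[OF h(1)] by simp
    then obtain \<delta> where \<delta>: "\<delta> > 0"
        "\<And>p p'. dist p' p < \<delta> \<Longrightarrow> dist (case p' of (x, y) \<Rightarrow> h x y) (case p of (x, y) \<Rightarrow> h x y) < \<eta>"
      using \<eta> unfolding uniformly_continuous_on_def by blast
    have "\<bar>T f x - T f y\<bar> \<le> \<eta> * q f" if "dist x y < \<delta>" for x y f
    proof -
      have "norm (h x z - h y z) \<le> \<eta>" for z
        using \<delta>(2)[of "(x, z)" "(y, z)"] that by (simp add: dist_Pair_Pair dist_norm)
      then have "norm (\<kappa> x - \<kappa> y) \<le> \<eta>" by (intro norm_bound) (simp add: \<kappa>)
      then have "q (\<kappa> x - \<kappa> y) \<le> \<eta>" using q_le_norm order_trans by blast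
      then show ?thesis
        using Cauchy_Schwarz[of "\<kappa> x - \<kappa> y" f] mult_right_mono[of "q (\<kappa> x - \<kappa> y)" \<eta> "q f"]
        by (simp add: T\<kappa> ip_simps)
    qed
    with \<delta>(1) show ?thesis by blast
  qed
  have "smoothing_operator ip T H"
  proof (intro smoothing_operator.intro smoothing_operator_axioms.intro semi_inner_axioms)
    show "linear T"
    proof (rule linearI)
      show "T (f + g) = T f + T g" for f g
        by (rule bcontfun_eqI) (simp add: T\<kappa> ip_simps)
      show "T (c *\<^sub>R f) = c *\<^sub>R T f" for f c
        by (rule bcontfun_eqI) (simp add: T\<kappa> ip_simps)
    qed
    show "norm (T f) \<le> H * q f" for f
      using Tx by (intro norm_bound) simp
    show "0 < H" by fact
    show "ip (T f) g = ip f (T g)" for f g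
    proof -
      have c: "continuous_on UNIV (\<lambda>(x, y). h x y * f y * g x)"
        using continuous_on_mult[OF continuous_on_mult[OF h(1)
            continuous_on_pair_projections(2)[OF continuous_on_apply_bcontfun]]
            continuous_on_pair_projections(1)[OF continuous_on_apply_bcontfun], of f g]
        by (simp add: case_prod_unfold)
      have "ip (T f) g = (\<integral>x. (\<integral>y. h x y * f y * g x \<partial>Q) \<partial>Q)"
        by (simp add: ip_def T)
      also have "\<dots> = (\<integral>y. (\<integral>x. h x y * f y * g x \<partial>Q) \<partial>Q)"
        by (rule continuous_Fubini[OF _ _ c]) unfold_locales
      also have "\<dots> = (\<integral>y. f y * (\<integral>x. h y x * g x \<partial>Q) \<partial>Q)"
        by (subst h(2)) (simp add: mult_ac flip: integral_mult_right_zero)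
      finally show ?thesis by (simp add: ip_def T)
    qed
    fix F :: "nat \<Rightarrow> 'a \<Rightarrow>\<^sub>C real" assume F: "\<And>n. q (F n) \<le> 1"
    obtain d :: "nat \<Rightarrow> 'a" where d: "\<And>x e. e > 0 \<Longrightarrow> \<exists>n. dist x (d n) < e"
      using compact_imp_dense_sequence[OF compact] by blast
    have bnd: "norm (T (F n) x) \<le> H" for n x
      using order_trans[OF Tx mult_left_mono[OF F less_imp_le[OF H(2)]]] by simp
    have "countable (range d)" by simp
    then obtain r where r: "strict_mono (r :: nat \<Rightarrow> nat)"
        "\<And>x. x \<in> range d \<Longrightarrow> \<exists>l. (\<lambda>n. T (F (r n)) x) \<longlonglongrightarrow> l"
      using function_convergent_subsequence[of "range d" "\<lambda>n. T (F n)" H] bnd by metis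
    have "Cauchy (\<lambda>n. T (F (r n)))"
    proof (rule metric_CauchyI)
      fix e :: real assume e: "e > 0"
      then obtain \<delta> where \<delta>: "\<delta> > 0"
          "\<And>x y f. dist x y < \<delta> \<Longrightarrow> \<bar>T f x - T f y\<bar> \<le> e / 4 * q f"
        using equi[of "e / 4"] by auto
      have eq: "\<bar>T (F n) x - T (F n) y\<bar> \<le> e / 4" if "dist x y < \<delta>" for n x y
        using order_trans[OF \<delta>(2)[OF that] mult_left_mono[OF F]] e by simp
      have "UNIV \<subseteq> (\<Union>j. ball (d j) \<delta>)" using d[OF \<delta>(1)] by (auto simp: dist_commute)
      then obtain J where J: "finite J" "UNIV \<subseteq> (\<Union>j\<in>J. ball (d j) \<delta>)"
        using compactE_image[OF compact, of UNIV "\<lambda>j. ball (d j) \<delta>"] by auto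
      have "\<exists>N. \<forall>m\<ge>N. \<forall>n\<ge>N. dist (T (F (r m)) (d j)) (T (F (r n)) (d j)) < e / 4" for j
        using r(2)[of "d j"] e
        by (intro metric_CauchyD convergent_Cauchy) (auto simp: convergent_def)
      then obtain N where N: "\<And>j m n. m \<ge> N j \<Longrightarrow> n \<ge> N j \<Longrightarrow>
          dist (T (F (r m)) (d j)) (T (F (r n)) (d j)) < e / 4" by metis
      define N0 where "N0 = Max (N ` J)"
      have "dist (T (F (r m))) (T (F (r n))) < e" if mn: "m \<ge> N0" "n \<ge> N0" for m n
      proof -
        \<comment> \<open>Compare at a net point \<open>d j\<close>: three errors of
          \<open>e / 4\<close>. The supremum over \<open>x\<close> preserves only the weak
          inequality, and the spare quarter makes it strict.\<close>
        have "dist (T (F (r m)) x) (T (F (r n)) x) \<le> 3 / 4 * e" for x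
        proof -
          obtain j where j: "j \<in> J" "dist (d j) x < \<delta>" using J(2) by (auto simp: subset_iff)
          then have "N j \<le> N0" using J(1) by (auto simp: N0_def)
          then have "\<bar>T (F (r m)) (d j) - T (F (r n)) (d j)\<bar> < e / 4"
            using N[of j m n] mn by (simp add: dist_real_def)
          then show ?thesis
            using eq[OF j(2), of "r m"] eq[OF j(2), of "r n"] unfolding dist_real_def by linarith
        qed
        then have "dist (T (F (r m))) (T (F (r n))) \<le> 3 / 4 * e" by (rule dist_bound)
        then show ?thesis using e by simp
      qed
      then show "\<exists>N. \<forall>m\<ge>N. \<forall>n\<ge>N. dist (T (F (r m))) (T (F (r n))) < e" by blast
    qed
    then show "\<exists>r. strict_mono (r :: nat \<Rightarrow> nat) \<and> convergent (\<lambda>n. T (F (r n)))"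
      using r(1) Cauchy_convergent by blast
  qed
  then show ?thesis unfolding ip_def .
qed

end

section \<open>Normalized similarity kernels\<close>

text \<open>Eigenvectors lie in the generalized eigenspace with exponent 1, and a basis whose
  cardinality is 1 is a single vector.\<close>

lemma eigenvector_in_span_if_simple:
  assumes "algebraic_multiplicity T t = 1" "eigenpair T t u" "T f = t *\<^sub>R f"
  shows "f \<in> span {u}"
proof -
  have gen: "g \<in> generalized_eigenspace T t" if "T g = t *\<^sub>R g" for g
    unfolding generalized_eigenspace_def using that by (auto intro!: exI[of _ 1])
  obtain B where B: "generalized_eigenspace T t \<subseteq> span B" "card B = dim (generalized_eigenspace T t)"
    using basis_exists by blast
  then obtain b where b: "B = {b}"
    using assms(1) by (auto simp: algebraic_multiplicity_def card_1_singleton_iff)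
  have "u \<in> span {b}" "f \<in> span {b}"
    using B(1) b gen assms by (auto simp: eigenpair_def)
  then obtain c c' where c: "u = c *\<^sub>R b" "f = c' *\<^sub>R b"
    by (auto simp: span_singleton)
  then have "f = (c' / c) *\<^sub>R u" using assms(2) by (auto simp: eigenpair_def)
  then show ?thesis by (auto simp: span_singleton)
qed

text \<open>The seminorm \<open>q\<close> of the L2(P) inner product, spelled out so that the gap
  can be stated uniformly over measures.\<close>

definition L2_seminorm :: "'a measure \<Rightarrow> ('a::topological_space \<Rightarrow>\<^sub>C real) \<Rightarrow> real" where
  "L2_seminorm P f = sqrt (\<integral>y. f y * f y \<partial>P)"

text \<open>\<open>l\<close> and \<open>B\<close> bound the kernel independently of any measure, so
  constants built from them serve \<open>P\<close> and all empirical measures.\<close>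

locale bounded_similarity =
  fixes k :: "'a::metric_space \<Rightarrow> 'a \<Rightarrow> real" and l B :: real
  assumes compact: "compact (UNIV :: 'a set)"
    and similarity: "similarity_function k"
    and l_pos: "0 < l" and lower: "\<And>x y. l < k x y" and upper: "\<And>x y. k x y \<le> B"
begin

lemma B_pos: "0 < B"
  using l_pos lower[of undefined undefined] upper[of undefined undefined] by linarith

lemma k_continuous: "continuous_on UNIV (\<lambda>(x, y). k x y)"
  using similarity by (simp add: similarity_function_def)

lemma k_abs: "\<bar>k x y\<bar> \<le> B"
  using l_pos lower[of x y] upper[of x y] by simp

lemma degree_fun_bounds:
  assumes "compact_prob_space Q"
  shows "l \<le> degree_fun k Q x" "degree_fun k Q x \<le> B"
proof -
  interpret compact_prob_space Q by fact
  have i: "integrable Q (k x)"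
    by (rule continuous_integrable[OF continuous_on_arguments(1)[OF k_continuous]])
  have "(\<integral>y. l \<partial>Q) \<le> (\<integral>y. k x y \<partial>Q)"
    by (rule integral_mono[OF _ i]) (auto intro: less_imp_le lower)
  then show "l \<le> degree_fun k Q x" by (simp add: degree_fun_def prob_space)
  have "(\<integral>y. k x y \<partial>Q) \<le> (\<integral>y. B \<partial>Q)"
    by (rule integral_mono[OF i]) (auto intro: upper)
  then show "degree_fun k Q x \<le> B" by (simp add: degree_fun_def prob_space)
qed

lemma degree_product_ge:
  assumes "compact_prob_space Q"
  shows "l\<^sup>2 \<le> degree_fun k Q x * degree_fun k Q y" "l \<le> sqrt (degree_fun k Q x * degree_fun k Q y)"
proof -
  show *: "l\<^sup>2 \<le> degree_fun k Q x * degree_fun k Q y"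
    unfolding power2_eq_square using degree_fun_bounds(1)[OF assms] l_pos
    by (intro mult_mono') auto
  show "l \<le> sqrt (degree_fun k Q x * degree_fun k Q y)"
    using l_pos * by (intro real_le_rsqrt)
qed

lemma normalized_kernel_continuous:
  assumes "compact_prob_space Q"
  shows "continuous_on UNIV (\<lambda>(x, y). normalized_kernel k Q x y)"
proof -
  interpret compact_prob_space Q by fact
  have d: "continuous_on UNIV (degree_fun k Q)"
    unfolding degree_fun_def by (rule continuous_kernel_integral[OF compact prob_space_axioms sets k_continuous])
  have "degree_fun k Q x * degree_fun k Q y \<noteq> 0" for x y
    using degree_product_ge(1)[OF assms, of x y] l_pos by (metis not_le zero_less_power)
  then show ?thesis
    using k_continuous continuous_on_pair_projections[OF d]
    unfolding normalized_kernel_def case_prod_unfold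
    by (intro continuous_intros) auto
qed

lemma normalized_kernel_sym: "normalized_kernel k Q x y = normalized_kernel k Q y x"
  using similarity by (simp add: normalized_kernel_def similarity_function_def mult.commute)

lemma normalized_kernel_bound:
  assumes "compact_prob_space Q"
  shows "\<bar>normalized_kernel k Q x y\<bar> \<le> B / l"
proof -
  have "0 < sqrt (degree_fun k Q x * degree_fun k Q y)"
    using degree_product_ge(2)[OF assms, of x y] l_pos by linarith
  then have "\<bar>normalized_kernel k Q x y\<bar> = \<bar>k x y\<bar> / sqrt (degree_fun k Q x * degree_fun k Q y)"
    by (simp only: normalized_kernel_def abs_divide abs_of_pos)
  also have "\<dots> \<le> B / l"
    using k_abs degree_product_ge(2)[OF assms] l_pos B_pos by (intro frac_le) auto
  finally show ?thesis .
qed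

lemma apply_op:
  assumes "compact_prob_space Q"
  shows "normalized_op k Q f x = (\<integral>y. normalized_kernel k Q x y * f y \<partial>Q)"
proof -
  interpret compact_prob_space Q by fact
  show ?thesis by (rule apply_normalized_op[OF compact prob_space_axioms sets similarity])
qed

lemma smoothing_operator_normalized_op:
  assumes "compact_prob_space Q"
  shows "smoothing_operator (\<lambda>(f :: 'a \<Rightarrow>\<^sub>C real) (g :: 'a \<Rightarrow>\<^sub>C real). \<integral>y. f y * g y \<partial>Q)
    (normalized_op k Q) (B / l)"
proof -
  interpret compact_prob_space Q by fact
  show ?thesis
    using B_pos l_pos
    by (intro smoothing_operator_kernel[OF normalized_kernel_continuous[OF assms] normalized_kernel_sym
          normalized_kernel_bound[OF assms] _ apply_op[OF assms]]) simp
qed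

text \<open>Rationalizing gives the denominator \<open>sqrt a * sqrt b * (sqrt a + sqrt b)\<close>,
  which is at least \<open>2 * l ^ 3\<close>.\<close>

lemma inverse_sqrt_diff:
  fixes a b :: real
  assumes "l\<^sup>2 \<le> a" "l\<^sup>2 \<le> b"
  shows "\<bar>1 / sqrt a - 1 / sqrt b\<bar> \<le> \<bar>a - b\<bar> / (2 * l ^ 3)"
proof -
  have s: "l \<le> sqrt a" "l \<le> sqrt b" using assms l_pos by (auto intro: real_le_rsqrt)
  have ab: "0 \<le> a" "0 \<le> b" using assms zero_le_power2[of l] by linarith+
  have pos: "0 < sqrt a" "0 < sqrt b" "0 < sqrt a + sqrt b" using s l_pos by linarith+
  have "b - a = (sqrt b - sqrt a) * (sqrt a + sqrt b)"
    using ab by (simp add: algebra_simps)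
  then have "1 / sqrt a - 1 / sqrt b = (b - a) / ((sqrt a * sqrt b) * (sqrt a + sqrt b))"
    using pos by (simp add: diff_divide_distrib)
  then have "\<bar>1 / sqrt a - 1 / sqrt b\<bar> = \<bar>a - b\<bar> / ((sqrt a * sqrt b) * (sqrt a + sqrt b))"
    using pos by (simp add: abs_mult abs_minus_commute)
  also have "\<dots> \<le> \<bar>a - b\<bar> / ((l * l) * (l + l))"
    using s l_pos pos by (intro divide_left_mono mult_mono add_mono mult_pos_pos add_pos_pos) auto
  finally show ?thesis by (simp add: power3_eq_cube mult_ac)
qed

text \<open>The two kernels share the numerator \<open>k x y\<close> and differ only in the degrees,
  so the degree error alone controls the difference.\<close>

lemma normalized_kernel_diff:
  assumes P: "compact_prob_space P" and Q: "compact_prob_space Q"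
    and eps: "\<And>x. \<bar>degree_fun k Q x - degree_fun k P x\<bar> \<le> eps"
  shows "\<bar>normalized_kernel k Q x y - normalized_kernel k P x y\<bar> \<le> B\<^sup>2 / l ^ 3 * eps"
proof -
  let ?p = "degree_fun k P" and ?q = "degree_fun k Q"
  have "\<bar>?q x * ?q y - ?p x * ?p y\<bar> = \<bar>?q x * (?q y - ?p y) + (?q x - ?p x) * ?p y\<bar>"
    by (simp add: algebra_simps)
  also have "\<dots> \<le> \<bar>?q x\<bar> * \<bar>?q y - ?p y\<bar> + \<bar>?q x - ?p x\<bar> * \<bar>?p y\<bar>"
    by (metis abs_mult abs_triangle_ineq)
  also have "\<dots> \<le> B * eps + eps * B"
  proof -
    have "\<bar>?q x\<bar> \<le> B" "\<bar>?p y\<bar> \<le> B"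
      using degree_fun_bounds[OF P, of y] degree_fun_bounds[OF Q, of x] l_pos by auto
    moreover have "0 \<le> eps" using eps[of x] by linarith
    ultimately show ?thesis using eps B_pos by (intro add_mono mult_mono) auto
  qed
  finally have prod: "\<bar>?q x * ?q y - ?p x * ?p y\<bar> \<le> 2 * B * eps" by simp
  have "\<bar>normalized_kernel k Q x y - normalized_kernel k P x y\<bar>
      = \<bar>k x y\<bar> * \<bar>1 / sqrt (?q x * ?q y) - 1 / sqrt (?p x * ?p y)\<bar>"
    by (simp add: normalized_kernel_def right_diff_distrib flip: abs_mult)
  also have "\<dots> \<le> B * (2 * B * eps / (2 * l ^ 3))"
  proof (rule mult_mono[OF k_abs])
    have "\<bar>1 / sqrt (?q x * ?q y) - 1 / sqrt (?p x * ?p y)\<bar> \<le> \<bar>?q x * ?q y - ?p x * ?p y\<bar> / (2 * l ^ 3)"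
      by (intro inverse_sqrt_diff degree_product_ge P Q)
    also have "\<dots> \<le> 2 * B * eps / (2 * l ^ 3)"
      using prod l_pos by (intro divide_right_mono) auto
    finally show "\<bar>1 / sqrt (?q x * ?q y) - 1 / sqrt (?p x * ?p y)\<bar> \<le> 2 * B * eps / (2 * l ^ 3)" .
  qed (use B_pos in auto)
  finally show ?thesis by (simp add: power2_eq_square mult_ac)
qed

section \<open>The residual of an empirical eigenfunction\<close>

text \<open>The difference of the operators is not small in operator norm. It is small on an
  eigenfunction \<open>v\<close> because \<open>v\<close> is itself, up to the factor \<open>\<mu>\<close>, an integral against the kernel;
  exchanging the integrals leaves the products of two kernels.\<close>

lemma normalized_op_diff_eigenvector:
  assumes P: "compact_prob_space P" and Q: "compact_prob_space Q"
    and deg: "\<And>x. \<bar>degree_fun k Q x - degree_fun k P x\<bar> \<le> eps"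
    and prod: "\<And>x y. \<bar>(\<integral>z. normalized_kernel k P x z * normalized_kernel k P y z \<partial>Q)
        - (\<integral>z. normalized_kernel k P x z * normalized_kernel k P y z \<partial>P)\<bar> \<le> eps"
    and v: "normalized_op k Q v = \<mu> *\<^sub>R v" "norm v = 1" and m: "0 < m" "m \<le> \<bar>\<mu>\<bar>"
  shows "norm (normalized_op k P v - \<mu> *\<^sub>R v)
    \<le> (B\<^sup>2 / l ^ 3 + (1 + 2 * (B / l) * (B\<^sup>2 / l ^ 3)) / m) * eps"
proof (rule norm_bound)
  fix x
  interpret P: compact_prob_space P by fact
  interpret Q: compact_prob_space Q by fact
  define E where "E = B\<^sup>2 / l ^ 3"
  define H where "H = B / l"
  define h where "h = normalized_kernel k P"
  define h' where "h' = normalized_kernel k Q"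
  \<comment> \<open>An intermediate function, with the kernel of \<open>P\<close> but the integral
    over \<open>Q\<close>. It separates the change of kernel, measured by \<open>\<delta>\<close>,
    from the change of measure.\<close>
  define g where "g y = (\<integral>z. h y z * v z \<partial>Q)" for y
  define \<delta> where "\<delta> y = \<mu> * v y - g y" for y
  have eps0: "0 \<le> eps" using deg[of x] by linarith
  have v1: "\<bar>v y\<bar> \<le> 1" for y using norm_bounded[of v y] v(2) by simp
  have hc: "continuous_on UNIV (\<lambda>(x, y). h x y)" "continuous_on UNIV (\<lambda>(x, y). h' x y)"
    unfolding h_def h'_def by (rule normalized_kernel_continuous[OF P] normalized_kernel_continuous[OF Q])+
  note hcx = continuous_on_arguments(1)[OF hc(1)] continuous_on_arguments(1)[OF hc(2)]
  have hH: "\<bar>h x y\<bar> \<le> H" for x y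
    unfolding h_def H_def by (rule normalized_kernel_bound[OF P])
  have vc: "continuous_on UNIV (apply_bcontfun v)" by simp
  have gc: "continuous_on UNIV g"
    unfolding g_def
    using continuous_on_mult[OF hc(1) continuous_on_pair_projections(2)[OF vc]]
    by (intro continuous_kernel_integral[OF compact Q.prob_space_axioms Q.sets]) (simp add: case_prod_unfold)
  have \<delta>c: "continuous_on UNIV \<delta>"
    unfolding \<delta>_def by (intro continuous_intros gc vc)
  have \<delta>: "\<bar>\<delta> y\<bar> \<le> E * eps" for y
  proof -
    have "\<mu> * v y = (\<integral>z. h' y z * v z \<partial>Q)"
      using apply_op[OF Q, of v y] v(1) by (simp add: h'_def)
    then have "\<delta> y = (\<integral>z. h' y z * v z - h y z * v z \<partial>Q)"
      unfolding \<delta>_def g_def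
      by (simp add: Q.continuous_integrable continuous_on_mult hcx vc)
    also have "\<bar>\<dots>\<bar> \<le> E * eps"
    proof (rule Q.integral_bound)
      show "continuous_on UNIV (\<lambda>z. h' y z * v z - h y z * v z)"
        by (intro continuous_intros hcx vc)
      fix z
      have "\<bar>h' y z * v z - h y z * v z\<bar> = \<bar>h' y z - h y z\<bar> * \<bar>v z\<bar>"
        by (simp add: left_diff_distrib flip: abs_mult)
      also have "\<dots> \<le> (E * eps) * 1"
        unfolding h_def h'_def E_def using normalized_kernel_diff[OF P Q deg] v1 eps0 l_pos
        by (intro mult_mono) auto
      finally show "\<bar>h' y z * v z - h y z * v z\<bar> \<le> E * eps" by simp
    qed
    finally show ?thesis .
  qed
  have split: "\<mu> * (\<integral>y. h x y * v y \<partial>R) = (\<integral>y. h x y * g y \<partial>R) + (\<integral>y. h x y * \<delta> y \<partial>R)"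
    and small: "\<bar>\<integral>y. h x y * \<delta> y \<partial>R\<bar> \<le> H * (E * eps)"
    if R: "compact_prob_space R" for R
  proof -
    interpret R: compact_prob_space R by fact
    have "\<mu> * (\<integral>y. h x y * v y \<partial>R) = (\<integral>y. h x y * g y + h x y * \<delta> y \<partial>R)"
      by (simp add: \<delta>_def algebra_simps flip: integral_mult_right_zero)
    also have "\<dots> = (\<integral>y. h x y * g y \<partial>R) + (\<integral>y. h x y * \<delta> y \<partial>R)"
      by (intro Bochner_Integration.integral_add R.continuous_integrable continuous_intros hcx gc \<delta>c)
    finally show "\<mu> * (\<integral>y. h x y * v y \<partial>R) = (\<integral>y. h x y * g y \<partial>R) + (\<integral>y. h x y * \<delta> y \<partial>R)" .
    show "\<bar>\<integral>y. h x y * \<delta> y \<partial>R\<bar> \<le> H * (E * eps)"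
    proof (rule R.integral_bound)
      show "continuous_on UNIV (\<lambda>y. h x y * \<delta> y)" by (intro continuous_intros hcx \<delta>c)
      show "\<bar>h x y * \<delta> y\<bar> \<le> H * (E * eps)" for y
        unfolding abs_mult using hH \<delta> order_trans[OF abs_ge_zero hH] by (intro mult_mono) auto
    qed
  qed
  \<comment> \<open>After Fubini \<open>v\<close> is only a weight bounded by 1, and
    \<open>R\<close> integrates a product of two kernel sections, a member of the error
    class.\<close>
  have swap: "(\<integral>y. h x y * g y \<partial>R) = (\<integral>z. v z * (\<integral>y. h x y * h z y \<partial>R) \<partial>Q)"
    if R: "compact_prob_space R" for R
  proof -
    have c: "continuous_on UNIV (\<lambda>(y, z). h x y * (h y z * v z))"
      using continuous_on_mult[OF continuous_on_pair_projections(1)[OF hcx(1)]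
          continuous_on_mult[OF hc(1) continuous_on_pair_projections(2)[OF vc]], of x]
      by (simp add: case_prod_unfold)
    have "(\<integral>y. h x y * g y \<partial>R) = (\<integral>y. (\<integral>z. h x y * (h y z * v z) \<partial>Q) \<partial>R)"
      by (simp add: g_def)
    also have "\<dots> = (\<integral>z. (\<integral>y. h x y * (h y z * v z) \<partial>R) \<partial>Q)"
      by (rule continuous_Fubini[OF R Q c])
    also have "\<dots> = (\<integral>z. (\<integral>y. v z * (h x y * h z y) \<partial>R) \<partial>Q)"
      by (intro Bochner_Integration.integral_cong refl)
        (simp add: h_def normalized_kernel_sym[of P _ z for z] mult_ac)
    finally show ?thesis by simp
  qed
  have hhc: "continuous_on UNIV (\<lambda>z. v z * (\<integral>y. h x y * h z y \<partial>R))" if R: "compact_prob_space R" for R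
  proof -
    interpret R: compact_prob_space R by fact
    have "continuous_on UNIV (\<lambda>(z, y). h x y * h z y)"
      using continuous_on_mult[OF continuous_on_pair_projections(2)[OF hcx(1)] hc(1), of x]
      by (simp add: case_prod_unfold)
    then show ?thesis
      by (intro continuous_intros vc continuous_kernel_integral[OF compact R.prob_space_axioms R.sets])
  qed
  have main: "\<bar>(\<integral>y. h x y * g y \<partial>P) - (\<integral>y. h x y * g y \<partial>Q)\<bar> \<le> eps"
  proof -
    have "(\<integral>y. h x y * g y \<partial>P) - (\<integral>y. h x y * g y \<partial>Q)
      = (\<integral>z. v z * (\<integral>y. h x y * h z y \<partial>P) - v z * (\<integral>y. h x y * h z y \<partial>Q) \<partial>Q)"
      unfolding swap[OF P] swap[OF Q]
      by (rule Bochner_Integration.integral_diff[symmetric]; intro Q.continuous_integrable hhc P Q)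
    also have "\<bar>\<dots>\<bar> \<le> eps"
    proof (rule Q.integral_bound)
      show "continuous_on UNIV (\<lambda>z. v z * (\<integral>y. h x y * h z y \<partial>P) - v z * (\<integral>y. h x y * h z y \<partial>Q))"
        by (intro continuous_on_diff hhc P Q)
      fix z
      have "\<bar>v z * (\<integral>y. h x y * h z y \<partial>P) - v z * (\<integral>y. h x y * h z y \<partial>Q)\<bar>
          = \<bar>v z\<bar> * \<bar>(\<integral>y. h x y * h z y \<partial>Q) - (\<integral>y. h x y * h z y \<partial>P)\<bar>"
        by (simp add: abs_minus_commute flip: abs_mult right_diff_distrib)
      also have "\<dots> \<le> 1 * eps"
        unfolding h_def by (intro mult_mono v1 prod) auto
      finally show "\<bar>v z * (\<integral>y. h x y * h z y \<partial>P) - v z * (\<integral>y. h x y * h z y \<partial>Q)\<bar> \<le> eps" by simp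
    qed
    finally show ?thesis .
  qed
  define p where "p = (\<integral>y. h x y * v y \<partial>P)"
  \<comment> \<open>\<open>p\<close> and \<open>g x\<close> integrate the same function against
    \<open>P\<close> and \<open>Q\<close>. The products of kernels contribute \<open>eps\<close>,
    the two integrals of \<open>\<delta>\<close> contribute \<open>2 * H * E * eps\<close>; going
    from \<open>g x\<close> to \<open>\<mu> v x\<close> afterwards adds
    \<open>E * eps\<close>.\<close>
  have "\<mu> * p - \<mu> * g x = ((\<integral>y. h x y * g y \<partial>P) - (\<integral>y. h x y * g y \<partial>Q))
      + (\<integral>y. h x y * \<delta> y \<partial>P) - (\<integral>y. h x y * \<delta> y \<partial>Q)"
    unfolding p_def using split[OF P] split[OF Q] by (simp add: g_def)
  then have "\<bar>\<mu> * p - \<mu> * g x\<bar> \<le> eps + H * (E * eps) + H * (E * eps)"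
    using main small[OF P] small[OF Q] by linarith
  moreover have "\<bar>\<mu>\<bar> * \<bar>p - g x\<bar> = \<bar>\<mu> * p - \<mu> * g x\<bar>"
    by (simp only: abs_mult[symmetric] right_diff_distrib)
  ultimately have "\<bar>\<mu>\<bar> * \<bar>p - g x\<bar> \<le> (1 + 2 * H * E) * eps"
    by (simp add: algebra_simps)
  moreover have "m * \<bar>p - g x\<bar> \<le> \<bar>\<mu>\<bar> * \<bar>p - g x\<bar>" using m by (intro mult_right_mono) auto
  ultimately have "m * \<bar>p - g x\<bar> \<le> (1 + 2 * H * E) * eps" by linarith
  then have "\<bar>p - g x\<bar> \<le> (1 + 2 * H * E) / m * eps" using m by (simp add: field_simps)
  moreover have "p - \<mu> * v x = (p - g x) - \<delta> x" by (simp add: \<delta>_def)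
  ultimately have "\<bar>p - \<mu> * v x\<bar> \<le> (1 + 2 * H * E) / m * eps + E * eps"
    using \<delta>[of x] by linarith
  then have "\<bar>p - \<mu> * v x\<bar> \<le> (E + (1 + 2 * H * E) / m) * eps" by (simp add: algebra_simps)
  then show "norm ((normalized_op k P v - \<mu> *\<^sub>R v) x)
      \<le> (B\<^sup>2 / l ^ 3 + (1 + 2 * (B / l) * (B\<^sup>2 / l ^ 3)) / m) * eps"
    using apply_op[OF P, of v x] by (simp add: p_def h_def E_def H_def)
qed

text \<open>A real \<open>SUP\<close> dominates its members only if the set is bounded, so this is
  what turns the supremum into a usable error bound. The constant adds up the bounds of the three
  subclasses.\<close>

lemma error_class_bdd_above:
  assumes P: "compact_prob_space P" and Q: "compact_prob_space Q" and u: "norm u = 1"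
  shows "bdd_above ((\<lambda>f. \<bar>(\<integral>y. f y \<partial>Q) - (\<integral>y. f y \<partial>P)\<bar>) ` error_class k P u)"
proof (rule bdd_aboveI2)
  interpret P: compact_prob_space P by fact
  interpret Q: compact_prob_space Q by fact
  let ?C = "B + B / l + (B / l)\<^sup>2"
  have C: "0 \<le> B / l" "0 \<le> (B / l)\<^sup>2" using B_pos l_pos by auto
  then have le_C: "B \<le> ?C" "1 * (B / l) \<le> ?C" "(B / l) * (B / l) \<le> ?C"
    using B_pos by (simp_all only: power2_eq_square)
  have hc: "continuous_on UNIV (normalized_kernel k P x)" for x
    by (rule continuous_on_arguments[OF normalized_kernel_continuous[OF P]])
  note hH = normalized_kernel_bound[OF P]
  fix f assume "f \<in> error_class k P u"
  then have f: "continuous_on UNIV f \<and> (\<forall>y. \<bar>f y\<bar> \<le> ?C)"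
    unfolding error_class_def
  proof (elim UnE)
    assume "f \<in> {k x |x. True}"
    then show ?thesis
      using continuous_on_arguments(1)[OF k_continuous] order_trans[OF k_abs le_C(1)] by blast
  next
    assume "f \<in> {\<lambda>y. u y * normalized_kernel k P x y |x. True}"
    then obtain x where x: "f = (\<lambda>y. u y * normalized_kernel k P x y)" by blast
    have "\<bar>f y\<bar> \<le> 1 * (B / l)" for y
      unfolding x abs_mult using norm_bounded[of u y] u by (intro mult_mono hH) auto
    moreover have "continuous_on UNIV f" unfolding x by (intro continuous_intros hc) auto
    ultimately show ?thesis using order_trans[OF _ le_C(2)] by blast
  next
    assume "f \<in> {\<lambda>z. normalized_kernel k P x z * normalized_kernel k P y z |x y. True}"
    then obtain x y where x: "f = (\<lambda>z. normalized_kernel k P x z * normalized_kernel k P y z)" by blast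
    have "\<bar>f z\<bar> \<le> (B / l) * (B / l)" for z
      unfolding x abs_mult using C by (intro mult_mono hH) auto
    moreover have "continuous_on UNIV f" unfolding x by (intro continuous_intros hc)
    ultimately show ?thesis using order_trans[OF _ le_C(3)] by blast
  qed
  show "\<bar>(\<integral>y. f y \<partial>Q) - (\<integral>y. f y \<partial>P)\<bar> \<le> 2 * ?C"
    using P.integral_bound[of f ?C] Q.integral_bound[of f ?C] f by fastforce
qed

text \<open>The gap is a hypothesis here, so that \<open>\<delta>\<close> can be fixed before the
  measure. From \<open>|\<mu> - lam| \<le> \<delta> / 2\<close> and
  \<open>\<delta> \<le> |lam|\<close> comes \<open>|\<mu>| \<ge> |lam| / 2\<close>, the value used
  for \<open>m\<close>.\<close>

lemma eigenfunction_error: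
  assumes P: "compact_prob_space P" and Q: "compact_prob_space Q"
    and lam: "lam \<noteq> 0" and u: "eigenpair (normalized_op k P) lam u" "norm u = 1"
    and \<delta>: "\<delta> > 0" "\<delta> \<le> \<bar>lam\<bar>"
    and gap: "\<And>w. (\<integral>y. apply_bcontfun w y * apply_bcontfun u y \<partial>P) = 0 \<Longrightarrow>
      \<delta> * L2_seminorm P w \<le> L2_seminorm P (normalized_op k P w - lam *\<^sub>R w)"
    and v: "eigenpair (normalized_op k Q) \<mu> v" "norm v = 1" and \<mu>: "\<bar>\<mu> - lam\<bar> \<le> \<delta> / 2"
  shows "\<exists>a\<in>{1, -1}. norm (a *\<^sub>R v - u)
    \<le> 4 / \<bar>lam\<bar> * (2 * (B / l) / \<delta> + 1 + (B / l) / \<bar>lam\<bar>)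
      * (B\<^sup>2 / l ^ 3 + (1 + 2 * (B / l) * (B\<^sup>2 / l ^ 3)) / (\<bar>lam\<bar> / 2))
      * (SUP f\<in>error_class k P u. \<bar>(\<integral>y. f y \<partial>Q) - (\<integral>y. f y \<partial>P)\<bar>)"
proof -
  interpret smoothing_operator "\<lambda>(f :: 'a \<Rightarrow>\<^sub>C real) (g :: 'a \<Rightarrow>\<^sub>C real). \<integral>y. f y * g y \<partial>P"
    "normalized_op k P" "B / l"
    by (rule smoothing_operator_normalized_op[OF P])
  define eps where "eps = (SUP f\<in>error_class k P u. \<bar>(\<integral>y. f y \<partial>Q) - (\<integral>y. f y \<partial>P)\<bar>)"
  have eps: "\<bar>(\<integral>y. f y \<partial>Q) - (\<integral>y. f y \<partial>P)\<bar> \<le> eps" if "f \<in> error_class k P u" for f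
    unfolding eps_def by (rule cSUP_upper[OF that error_class_bdd_above[OF P Q u(2)]])
  have r: "norm (normalized_op k P v - \<mu> *\<^sub>R v)
      \<le> (B\<^sup>2 / l ^ 3 + (1 + 2 * (B / l) * (B\<^sup>2 / l ^ 3)) / (\<bar>lam\<bar> / 2)) * eps"
  proof (rule normalized_op_diff_eigenvector[OF P Q])
    show "\<bar>degree_fun k Q x - degree_fun k P x\<bar> \<le> eps" for x
      unfolding degree_fun_def by (rule eps) (auto simp: error_class_def)
    show "\<bar>(\<integral>z. normalized_kernel k P x z * normalized_kernel k P y z \<partial>Q)
        - (\<integral>z. normalized_kernel k P x z * normalized_kernel k P y z \<partial>P)\<bar> \<le> eps" for x y
      by (rule eps) (auto simp: error_class_def)
    show "\<bar>lam\<bar> / 2 \<le> \<bar>\<mu>\<bar>" using \<mu> \<delta> by linarith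
  qed (use v lam in \<open>auto simp: eigenpair_def\<close>)
  obtain a where a: "a \<in> {1, -1}" "norm (a *\<^sub>R v - u)
      \<le> 4 / \<bar>lam\<bar> * (2 * (B / l) / \<delta> + 1 + (B / l) / \<bar>lam\<bar>) * norm (normalized_op k P v - \<mu> *\<^sub>R v)"
    using eigenvector_perturbation[OF lam _ u(2) \<delta> _ \<mu> v(2)] u(1) gap
    unfolding eigenpair_def q_def L2_seminorm_def by blast
  have "0 \<le> 4 / \<bar>lam\<bar> * (2 * (B / l) / \<delta> + 1 + (B / l) / \<bar>lam\<bar>)"
    using B_pos l_pos \<delta> by auto
  from mult_left_mono[OF r this] a show ?thesis
    unfolding eps_def[symmetric] by (intro bexI[of _ a]) (auto simp: mult.assoc)
qed

text \<open>The gap depends on \<open>P\<close> through the spectrum only: one measure with spectrum \<open>S\<close> shows that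
  \<open>\<lambda>\<close> is isolated in \<open>S\<close>, and the gap of any other one is attained at the distance of \<open>\<lambda>\<close> to a
  further point of \<open>S\<close>.\<close>

lemma uniform_spectral_gap:
  assumes lam: "lam \<noteq> 0"
  shows "\<exists>\<delta>>0. \<delta> \<le> \<bar>lam\<bar> \<and> (\<forall>P u (w).
    compact_prob_space P \<and> spectrum (normalized_op k P) = S \<and>
    algebraic_multiplicity (normalized_op k P) lam = 1 \<and> eigenpair (normalized_op k P) lam u \<and>
    (\<integral>y. apply_bcontfun w y * apply_bcontfun u y \<partial>P) = 0 \<longrightarrow>
      \<delta> * L2_seminorm P w \<le> L2_seminorm P (normalized_op k P w - lam *\<^sub>R w))"
proof -
  define good where "good P u \<longleftrightarrow> compact_prob_space P \<and> spectrum (normalized_op k P) = S \<and>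
    algebraic_multiplicity (normalized_op k P) lam = 1 \<and> eigenpair (normalized_op k P) lam u" for P u
  define gap where "gap P u gam \<longleftrightarrow> (\<forall>w. (\<integral>y. apply_bcontfun w y * apply_bcontfun u y \<partial>P) = 0 \<longrightarrow>
      gam * L2_seminorm P w \<le> L2_seminorm P (normalized_op k P w - lam *\<^sub>R w))" for P u and gam :: real
  have gap_mono: "gap P u \<delta>" if "gap P u gam" "\<delta> \<le> gam" for P u gam \<delta>
  proof -
    have "\<delta> * L2_seminorm P w
        \<le> gam * L2_seminorm P w" for w
      by (rule mult_right_mono[OF that(2)]) (simp add: L2_seminorm_def)
    with that(1) show ?thesis unfolding gap_def by (meson order_trans)
  qed
  have ex_gap: "\<exists>gam>0. gap P u gam \<and> (gam \<ge> \<bar>lam\<bar> \<or> lam + gam \<in> S \<or> lam - gam \<in> S)"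
    and isolated: "\<And>gam t. gam > 0 \<Longrightarrow> gap P u gam \<Longrightarrow> t \<in> S \<Longrightarrow> t \<noteq> 0 \<Longrightarrow> t \<noteq> lam \<Longrightarrow> gam \<le> \<bar>t - lam\<bar>"
    if P: "good P u" for P u
  proof -
    interpret smoothing_operator "\<lambda>(f :: 'a \<Rightarrow>\<^sub>C real) (g :: 'a \<Rightarrow>\<^sub>C real). \<integral>y. f y * g y \<partial>P"
      "normalized_op k P" "B / l"
      using P smoothing_operator_normalized_op by (simp add: good_def)
    have u: "normalized_op k P u = lam *\<^sub>R u" "u \<noteq> 0" and S: "spectrum (normalized_op k P) = S"
      using P by (auto simp: good_def eigenpair_def)
    have "f \<in> span {u}" if "normalized_op k P f = lam *\<^sub>R f" for f
      using P that eigenvector_in_span_if_simple unfolding good_def by blast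
    then show "\<exists>gam>0. gap P u gam \<and> (gam \<ge> \<bar>lam\<bar> \<or> lam + gam \<in> S \<or> lam - gam \<in> S)"
      using spectral_gap[OF lam u] unfolding gap_def q_def S L2_seminorm_def by blast
    show "gam \<le> \<bar>t - lam\<bar>" if "gam > 0" "gap P u gam" "t \<in> S" "t \<noteq> 0" "t \<noteq> lam" for gam t
      using isolated_in_spectrum[OF lam u that(1) _ _ that(4,5)] that(2,3) unfolding gap_def q_def S L2_seminorm_def by blast
  qed
  have "\<exists>\<delta>>0. \<delta> \<le> \<bar>lam\<bar> \<and> (\<forall>P u. good P u \<longrightarrow> gap P u \<delta>)"
  proof (cases "\<exists>P u. good P u")
    case True
    then obtain P0 u0 gam0 where P0: "good P0 u0" "gam0 > 0" "gap P0 u0 gam0" using ex_gap by blast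
    \<comment> \<open>The cap at \<open>|lam|\<close> covers a possible point 0 of \<open>S\<close>,
      to which \<open>isolated\<close> does not apply, and also the alternative
      \<open>gam \<ge> |lam|\<close>.\<close>
    define \<delta> where "\<delta> = min gam0 \<bar>lam\<bar>"
    have "gap P u \<delta>" if P: "good P u" for P u
    proof -
      obtain gam where gam: "gam > 0" "gap P u gam" "gam \<ge> \<bar>lam\<bar> \<or> lam + gam \<in> S \<or> lam - gam \<in> S"
        using ex_gap[OF P] by blast
      have "\<delta> \<le> \<bar>t - lam\<bar>" if "t \<in> S" "t \<noteq> lam" for t
        using isolated[OF P0, of t] that by (cases "t = 0") (auto simp: \<delta>_def)
      then have "\<delta> \<le> gam"
        using gam by (elim disjE) (force simp: \<delta>_def)+
      then show ?thesis using gap_mono gam(2) by blast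
    qed
    then show ?thesis using P0(2) lam by (intro exI[of _ \<delta>]) (auto simp: \<delta>_def)
  next
    case False
    then show ?thesis using lam by (intro exI[of _ "\<bar>lam\<bar>"]) auto
  qed
  then show ?thesis unfolding good_def gap_def by blast
qed

end

text \<open>The estimate is deterministic for each sample; it sets in once \<open>ev n\<close> is
  within half of the uniform gap of \<open>lam\<close>. The constant is assembled from
  \<open>l\<close>, \<open>B\<close>, \<open>lam\<close> and that gap before any measure
  appears.\<close>

theorem theorem16:
  fixes k :: "'a::metric_space \<Rightarrow> 'a \<Rightarrow> real" and S :: "real set" and lam :: real
  assumes "compact (UNIV :: 'a set)"
    and "similarity_function k"
    and "lam \<noteq> 0"
  shows "\<exists>C'>0. \<forall>(P :: 'a measure) (M :: 'w measure) X u.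
    full_support_prob P \<and> iid_sample P M X \<and>
    spectrum (normalized_op k P) = S \<and>
    simple_eigenvalue (normalized_op k P) lam \<and>
    eigenpair (normalized_op k P) lam u \<and> norm u = 1 \<longrightarrow>
    (\<forall>\<omega>\<in>space M.
      let Pn = empirical_measure (\<lambda>i. X i \<omega>) in
      \<forall>ev ef.
        (\<forall>n\<ge>1. eigenpair (normalized_op k (Pn n)) (ev n) (ef n) \<and> norm (ef n) = 1) \<and>
        ev \<longlonglongrightarrow> lam \<longrightarrow>
        (\<exists>a :: nat \<Rightarrow> real. (\<forall>n. a n \<in> {1, -1}) \<and>
          (\<forall>\<^sub>F n in sequentially.
            norm (a n *\<^sub>R ef n - u) \<le>
              C' * (SUP f\<in>error_class k P u. \<bar>(\<integral>y. f y \<partial>Pn n) - (\<integral>y. f y \<partial>P)\<bar>))))"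
proof -
  obtain l where l: "l > 0" "\<And>x y. k x y > l"
    using assms(2) by (auto simp: similarity_function_def)
  obtain B where B: "\<And>x y. \<bar>k x y\<bar> \<le> B"
    using continuous_pair_bounded[OF assms(1)] assms(2) by (auto simp: similarity_function_def)
  interpret bounded_similarity k l B
    using assms l B by unfold_locales (auto intro: order_trans[OF abs_ge_self])
  obtain \<delta> where \<delta>: "\<delta> > 0" "\<delta> \<le> \<bar>lam\<bar>" and gap: "\<And>P u (w).
    compact_prob_space P \<Longrightarrow> spectrum (normalized_op k P) = S \<Longrightarrow>
    algebraic_multiplicity (normalized_op k P) lam = 1 \<Longrightarrow> eigenpair (normalized_op k P) lam u \<Longrightarrow>
    (\<integral>y. apply_bcontfun w y * apply_bcontfun u y \<partial>P) = 0 \<Longrightarrow>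
      \<delta> * L2_seminorm P w \<le> L2_seminorm P (normalized_op k P w - lam *\<^sub>R w)"
    using uniform_spectral_gap[OF assms(3), of S] by blast
  define C where "C = 4 / \<bar>lam\<bar> * (2 * (B / l) / \<delta> + 1 + (B / l) / \<bar>lam\<bar>)
      * (B\<^sup>2 / l ^ 3 + (1 + 2 * (B / l) * (B\<^sup>2 / l ^ 3)) / (\<bar>lam\<bar> / 2))"
  have C: "C > 0"
    unfolding C_def using B_pos l_pos \<delta> assms(3)
    by (intro mult_pos_pos add_pos_pos divide_pos_pos zero_less_power) auto
  have main: "\<exists>a :: nat \<Rightarrow> real. (\<forall>n. a n \<in> {1, -1}) \<and>
      (\<forall>\<^sub>F n in sequentially. norm (a n *\<^sub>R ef n - u) \<le>
        C * (SUP f\<in>error_class k P u. \<bar>(\<integral>y. f y \<partial>empirical_measure x n) - (\<integral>y. f y \<partial>P)\<bar>))"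
    if P: "full_support_prob P" and S: "spectrum (normalized_op k P) = S"
      and simple: "simple_eigenvalue (normalized_op k P) lam"
      and u: "eigenpair (normalized_op k P) lam u" "norm u = 1"
      and ef: "\<And>n. n \<ge> 1 \<Longrightarrow> eigenpair (normalized_op k (empirical_measure x n)) (ev n) (ef n) \<and> norm (ef n) = 1"
      and ev: "ev \<longlonglongrightarrow> lam"
    for P :: "'a measure" and u ev ef x
  proof -
    define good where "good n a \<longleftrightarrow> a \<in> {1, -1} \<and> norm (a *\<^sub>R ef n - u) \<le>
        C * (SUP f\<in>error_class k P u. \<bar>(\<integral>y. f y \<partial>empirical_measure x n) - (\<integral>y. f y \<partial>P)\<bar>)" for n a
    have cP: "compact_prob_space P"
      using P assms(1) by (simp add: full_support_prob_def compact_prob_space_def compact_prob_space_axioms_def)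
    have "\<forall>\<^sub>F n in sequentially. \<bar>ev n - lam\<bar> < \<delta> / 2"
      using tendstoD[OF ev, of "\<delta> / 2"] \<delta> by (simp add: dist_real_def)
    then have ev_good: "\<forall>\<^sub>F n in sequentially. \<exists>a. good n a"
      \<comment> \<open>With no sample points there is no empirical probability measure, so
        \<open>n = 0\<close> is left out.\<close>
      using eventually_ge_at_top[of 1]
    proof eventually_elim
      case (elim n)
      have "compact_prob_space (empirical_measure x n)"
        using prob_space_empirical_measure[of n x] elim assms(1)
        by (simp add: compact_prob_space_def compact_prob_space_axioms_def)
      from eigenfunction_error[OF cP this assms(3) u \<delta> gap[OF cP S _ u(1)], of "ev n" "ef n"]
      show ?case
        using simple ef elim unfolding good_def C_def simple_eigenvalue_def by auto
    qed
    \<comment> \<open>The default sign 1 is taken at indices without a good sign; these are only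
      finitely many.\<close>
    define a where "a n = (if \<exists>a. good n a then SOME a. good n a else 1)" for n
    have "good n (a n)" if "\<exists>a. good n a" for n
      using someI_ex[OF that] that by (simp add: a_def)
    then have "(\<forall>n. a n \<in> {1, -1}) \<and> (\<forall>\<^sub>F n in sequentially. good n (a n))"
      using ev_good by (auto simp: good_def a_def elim: eventually_mono)
    then show ?thesis unfolding good_def by (auto elim: eventually_mono)
  qed
  show ?thesis
    unfolding Let_def using C main by (intro exI[of _ C]) blast
qed

end
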